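(* For every $t\in\mathbb{R}$ and every $\mathbb{V}\in\mathbb{S}^1$, $\mathbb{V}$ is not a tangent of $\phi(\mathbb{R})$ at $\phi(t)$; that is, for every $t\in\mathbb{R}$ and every $\mathbb{V}\in\mathbb{S}^1$ there exists $\varphi>0$ such that \[ \frac{\mathcal{H}^1_{\infty}\big( ( \phi(\mathbb{R}) \cap B(\phi(t),h) ) \setminus S(\phi(t),\mathbb{V},\varphi) \big)}{h} \] does not converge to $0$ as $h\to0^+$.
   Context: $\phi(t) = \sum_{k \in \mathbb{Z}} \frac{ e^{-4\pi^2 i k^2 t} - 1 }{-4\pi^2 k^2}$ for $t\in\mathbb{R}$, where the $k=0$ term is interpreted as its limit value $it$; we identify $\mathbb{C}$ with $\mathbb{R}^2$ and $\mathbb{S}^1$ with unit complex numbers. The 1-Hausdorff content of $F\subset\mathbb{R}^2$ is $\mathcal{H}^1_\infty(F)=\inf\{\sum_i \operatorname{diam}U_i : F\subset\bigcup_i U_i,\ \{U_i\} \text{ countable}\}$. $B(x,h)$ is the closed (or open) ball of radius $h$ centred at $x$. For $x\in\mathbb{R}^2$, $\mathbb{V}\in\mathbb{S}^1$, $\varphi>0$, $S(x,\mathbb{V},\varphi)$ is the closed double cone with vertex $x$, axis direction $\mathbb{V}$ and opening angle $\varphi$, i.e. the set of points $y$ with $y=x$ or such that the angle between the line through $x$ in direction $\mathbb{V}$ and the vector $y-x$ is at most $\varphi/2$. Definition: $\mathbb{V}\in\mathbb{S}^1$ is a tangent of $\phi(\mathbb{R})$ at $\phi(t)$ if for every $\varphi>0$,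 $\lim_{h\to0}\mathcal{H}^1_{\infty}\big((\phi(\mathbb{R})\cap B(\phi(t),h))\setminus S(\phi(t),\mathbb{V},\varphi)\big)/h=0$. *)

theory Defs
  imports "HOL-Analysis.Analysis"
begin

text \<open>Term of the series defining phi; the k = 0 term is its limit value i t.\<close>
definition phi_term :: "real \<Rightarrow> int \<Rightarrow> complex" where
  "phi_term t k = (if k = 0 then \<i> * complex_of_real t
     else (cis (- 4 * pi^2 * of_int k ^ 2 * t) - 1) / complex_of_real (- 4 * pi^2 * of_int k ^ 2))"

definition phi :: "real \<Rightarrow> complex" where
  "phi t = (\<Sum>\<^sub>\<infinity>k\<in>(UNIV::int set). phi_term t k)"

text \<open>1-Hausdorff content: infimum over countable covers (indexed by nat; finite covers
  are included by padding with empty sets, which have diameter 0).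
  Unbounded sets get diameter \<infinity> (Isabelle's diameter is only meaningful for bounded sets).\<close>
definition H1_content :: "complex set \<Rightarrow> ennreal" where
  "H1_content F = (INF U \<in> {U :: nat \<Rightarrow> complex set. F \<subseteq> (\<Union>i. U i)}.
       (\<Sum>i. if bounded (U i) then ennreal (diameter (U i)) else \<infinity>))"

definition cone :: "complex \<Rightarrow> complex \<Rightarrow> real \<Rightarrow> complex set" where
  "cone x v a = {y. y = x \<or> arccos (\<bar>v \<bullet> (y - x)\<bar> / norm (y - x)) \<le> a / 2}"

definition is_tangent :: "complex \<Rightarrow> real \<Rightarrow> bool" where
  "is_tangent v t \<longleftrightarrow> (\<forall>a>0. ((\<lambda>h. H1_content ((phi ` UNIV \<inter> cball (phi t) h)
        - cone (phi t) v a) / ennreal h) \<longlongrightarrow> 0) (at_right 0))"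

end

theory Submission
  imports Defs "HOL-Complex_Analysis.Complex_Analysis" "HOL-Probability.Characteristic_Functions" "HOL-Number_Theory.Cong"
begin

text \<open>
  A connected piece of the curve that leaves a cone around a line has 1-content at least its diameter, so a tangent
  at \<open>phi t\<close> would force the directions of \<open>phi (t + s) - phi t\<close> to converge in the projective line as \<open>s\<close> tends to 0.

  Poisson summation gives, with a constant independent of the rational \<open>p / q\<close> and for \<open>T = p / (2 * pi * q)\<close>,
  that \<open>phi (T + s) - phi T\<close> equals \<open>G(p, q) / (q * sqrt pi) * csqrt (\<i> * s)\<close> up to an error of order
  \<open>(q * \<bar>s\<bar>) powr (3/2)\<close>, where \<open>G(p, q)\<close> is a quadratic Gauss sum. Since \<open>csqrt (\<i> * s)\<close> turns by a right angle
  when \<open>s\<close> changes sign, the curve has a corner at \<open>T\<close> whenever \<open>G(p, q)\<close> is nonzero; for odd \<open>q\<close> this corner is visible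
  at parameter distance \<open>1 / q\<^sup>2\<close> and has size \<open>q powr (-3/2)\<close>. If \<open>2 * pi * t\<close> is irrational, it is approximated to order
  \<open>1 / Q\<^sup>2\<close> by rationals with odd denominator \<open>Q\<close>, whose corners are seen from \<open>phi t\<close> at a distance comparable to their
  size. If \<open>2 * pi * t\<close> is a rational with vanishing Gauss sum, then \<open>phi (t + s) - phi t = O(\<bar>s\<bar> powr (3/2))\<close>,
  and the same holds for approximation of order \<open>1 / Q\<close>.
\<close>

section \<open>Hausdorff content and tangents\<close>

text \<open>The derivative of \<open>phi_ext\<close> is a theta series whose terms have modulus 1 on
  the imaginary axis, where the curve lives. All estimates are therefore made in the open right
  half-plane, with constants independent of the distance to the axis, and reach the curve by
  continuity. The scale 1/q^2 is where, for odd q, the main term q^(-1/2) |s|^(1/2) and the error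
  q^(3/2) |s|^(3/2) reach the common order q^(-3/2). A small constant factor in |s| makes the main
  term win there, while up to distance 1/q^2 all increments are still O(q^(-3/2)). For the same
  reason flatness of order 3/2 can make up for an approximation of order only 1/Q: (1/Q)^(3/2) is
  again the size of the corner. Odd denominators are singled out because their Gauss sums have
  modulus exactly sqrt q, so that all these corners look alike after rescaling; for even q the sum
  can vanish, as it does for q = 2. The corner need not lie at \<open>phi t\<close>. Its vertex and
  two points on its orthogonal arms cannot all be close, relative to their distance, to one line
  through \<open>phi t\<close>.\<close>

lemma H1_content_ge_length:
  fixes f :: "complex \<Rightarrow> real"
  assumes lip: "\<And>x y. \<bar>f x - f y\<bar> \<le> norm (x - y)" and sub: "{a<..<b} \<subseteq> f ` F"
  shows "ennreal (b - a) \<le> H1_content F"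
  unfolding H1_content_def
proof (intro INF_greatest)
  fix U :: "nat \<Rightarrow> complex set"
  assume "U \<in> {U. F \<subseteq> (\<Union>i. U i)}"
  then have U: "F \<subseteq> (\<Union>i. U i)" by simp
  define J where "J i = (if bounded (U i) then (if U i = {} then {} else {Inf (f ` U i)..Sup (f ` U i)}) else UNIV)" for i
  have bdd: "bdd_above (f ` U i)" "bdd_below (f ` U i)" if b: "bounded (U i)" for i
  proof -
    obtain x0 e where e: "\<And>y. y \<in> U i \<Longrightarrow> dist x0 y \<le> e"
      using b unfolding bounded_def by blast
    have "\<bar>f y - f x0\<bar> \<le> e" if "y \<in> U i" for y
      using e[OF that] lip[of y x0] by (simp add: dist_norm norm_minus_commute)
    then have "f y \<le> f x0 + e" "f x0 - e \<le> f y" if "y \<in> U i" for y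
      using that by (auto simp: abs_le_iff) (smt (verit))+
    then show "bdd_above (f ` U i)" "bdd_below (f ` U i)"
      unfolding bdd_above_def bdd_below_def by blast+
  qed
  have sub1: "f ` U i \<subseteq> J i" for i
    using bdd[of i] by (auto simp: J_def intro: cINF_lower cSUP_upper)
  have len: "emeasure lborel (J i) \<le> (if bounded (U i) then ennreal (diameter (U i)) else \<infinity>)" for i
  proof (cases "bounded (U i) \<and> U i \<noteq> {}")
    case True
    have fxy: "f x - f y \<le> diameter (U i)" if "x \<in> U i" "y \<in> U i" for x y
      using lip[of x y] diameter_bounded_bound[of "U i" x y] True that by (auto simp: dist_norm)
    have "Sup (f ` U i) - diameter (U i) \<le> f y" if "y \<in> U i" for y
    proof -
      have "Sup (f ` U i) \<le> f y + diameter (U i)"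
        using True fxy[OF _ that] by (intro cSUP_least) (auto simp: algebra_simps)
      then show ?thesis by simp
    qed
    then have "Sup (f ` U i) - diameter (U i) \<le> Inf (f ` U i)"
      using True by (intro cINF_greatest) auto
    moreover have "Inf (f ` U i) \<le> Sup (f ` U i)"
      using True bdd[of i] by (meson cINF_lower cSUP_upper ex_in_conv order_trans)
    ultimately show ?thesis
      using True by (auto simp: J_def emeasure_lborel_Icc intro!: ennreal_leI)
  qed (auto simp: J_def)
  have meas [measurable]: "J i \<in> sets lborel" for i by (simp add: J_def)
  have "ennreal (b - a) \<le> emeasure lborel {a<..<b}"
    by (cases "a \<le> b") (auto simp: ennreal_neg)
  also have "\<dots> \<le> emeasure lborel (\<Union>i. J i)"
  proof (rule emeasure_mono)
    have "f ` F \<subseteq> (\<Union>i. f ` U i)" using image_mono[OF U, of f] by (simp add: image_UN)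
    also have "\<dots> \<subseteq> (\<Union>i. J i)" using sub1 by (intro UN_mono) auto
    finally show "{a<..<b} \<subseteq> (\<Union>i. J i)" using sub by (rule order_trans[rotated])
    show "(\<Union>i. J i) \<in> sets lborel" using meas by (intro sets.countable_UN) auto
  qed
  also have "\<dots> \<le> (\<Sum>i. emeasure lborel (J i))"
    by (rule emeasure_subadditive_countably) (use meas in blast)
  also have "\<dots> \<le> (\<Sum>i. if bounded (U i) then ennreal (diameter (U i)) else \<infinity>)"
    by (intro suminf_le len) auto
  finally show "ennreal (b - a) \<le> (\<Sum>i. if bounded (U i) then ennreal (diameter (U i)) else \<infinity>)" .
qed

lemma inner_ii_mult_Pythagoras:
  fixes v y :: complex
  assumes "norm v = 1"
  shows "(v \<bullet> y)\<^sup>2 + ((\<i> * v) \<bullet> y)\<^sup>2 = (norm y)\<^sup>2"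
proof -
  have "(Re v)\<^sup>2 + (Im v)\<^sup>2 = 1" using assms by (metis cmod_power2 one_power2)
  moreover have "(v \<bullet> y)\<^sup>2 + ((\<i> * v) \<bullet> y)\<^sup>2 = ((Re v)\<^sup>2 + (Im v)\<^sup>2) * ((Re y)\<^sup>2 + (Im y)\<^sup>2)"
    by (simp add: inner_complex_def power2_eq_square algebra_simps)
  ultimately show ?thesis by (simp add: cmod_power2)
qed

text \<open>The half-angle of this cone is arcsin \<open>k\<close>, written through
  \<open>arccos\<close> to match the definition of \<open>cone\<close>. A vector whose component
  orthogonal to the axis exceeds \<open>k\<close> times its length makes a larger angle with the
  axis.\<close>

lemma not_in_cone:
  assumes v: "norm v = 1" and k: "0 < k" "k < 1"
    and y: "k * norm (y - x) < \<bar>(\<i> * v) \<bullet> (y - x)\<bar>"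
  shows "y \<notin> cone x v (2 * arccos (sqrt (1 - k\<^sup>2)))"
proof -
  have yx: "y \<noteq> x" using y by auto
  then have n: "norm (y - x) > 0" by simp
  have "(k * norm (y - x))\<^sup>2 < ((\<i> * v) \<bullet> (y - x))\<^sup>2"
    using y k n by (metis abs_le_square_iff abs_of_nonneg mult_nonneg_nonneg less_imp_le not_less power2_abs)
  then have "(v \<bullet> (y - x))\<^sup>2 < (1 - k\<^sup>2) * (norm (y - x))\<^sup>2"
    using inner_ii_mult_Pythagoras[OF v, of "y - x"] by (simp add: power_mult_distrib algebra_simps)
  then have "(\<bar>v \<bullet> (y - x)\<bar> / norm (y - x))\<^sup>2 < 1 - k\<^sup>2"
    using n by (simp add: power_divide divide_simps)
  then have lt: "\<bar>v \<bullet> (y - x)\<bar> / norm (y - x) < sqrt (1 - k\<^sup>2)"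
    using real_less_rsqrt by blast
  have "sqrt (1 - k\<^sup>2) \<le> 1" by simp
  then have "arccos (sqrt (1 - k\<^sup>2)) < arccos (\<bar>v \<bullet> (y - x)\<bar> / norm (y - x))"
    using lt n by (intro arccos_less_arccos) (auto intro: order_trans[of _ 0])
  then show ?thesis using yx by (simp add: cone_def)
qed

text \<open>A single point off the axis has content 0; it is the arc joining it to
  \<open>g t\<close> that has content. This arc has to leave the neighbourhood of the axis, and the
  part of it outside a narrower cone has content proportional to the distance of the point from
  \<open>g t\<close>.\<close>

lemma not_tangent_if_transverse:
  fixes g :: "real \<Rightarrow> complex" and v :: complex
  assumes cont: "continuous_on UNIV g" and v: "norm v = 1" and c: "c > 0"
    and freq: "\<And>e. e > 0 \<Longrightarrow> \<exists>s. \<bar>s\<bar> < e \<and> g (t + s) \<noteq> g t \<and>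
         c * norm (g (t + s) - g t) \<le> \<bar>(\<i> * v) \<bullet> (g (t + s) - g t)\<bar>"
  shows "\<exists>a>0. \<not> ((\<lambda>h. H1_content ((g ` UNIV \<inter> cball (g t) h) - cone (g t) v a) / ennreal h) \<longlongrightarrow> 0) (at_right 0)"
proof -
  have inner_le: "\<bar>(\<i> * v) \<bullet> y\<bar> \<le> norm y" for y
    using Cauchy_Schwarz_ineq2[of "\<i> * v" y] v by (simp add: norm_mult)
  obtain s0 where "g (t + s0) \<noteq> g t" "c * norm (g (t + s0) - g t) \<le> \<bar>(\<i> * v) \<bullet> (g (t + s0) - g t)\<bar>"
    using freq[of 1] by auto
  then have "0 < norm (g (t + s0) - g t)" "c * norm (g (t + s0) - g t) \<le> 1 * norm (g (t + s0) - g t)" 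
    using inner_le[of "g (t + s0) - g t"] by (simp, linarith)
  from this(2,1) have c1: "c \<le> 1" by (rule mult_right_le_imp_le)
  \<comment> \<open>On the arc used below the transverse component exceeds \<open>c * r / 2\<close>
    and the distance from \<open>g t\<close> is less than \<open>2 * r\<close>; \<open>c / 4\<close>
    is the ratio of the two. It is also the lower bound obtained for the content divided by
    \<open>h = 2 * r\<close>.\<close>
  define k where "k = c / 4"
  have k: "0 < k" "k < 1" using c c1 by (auto simp: k_def)
  define a where "a = 2 * arccos (sqrt (1 - k\<^sup>2))"
  have "sqrt (1 - k\<^sup>2) < 1" "0 \<le> sqrt (1 - k\<^sup>2)"
    using k by (auto simp: power_le_one)
  then have a: "a > 0" unfolding a_def
    using arccos_less_arccos[of "sqrt (1 - k\<^sup>2)" 1] by (simp del: real_sqrt_ge_0_iff real_sqrt_lt_1_iff)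
  have "\<not> ((\<lambda>h. H1_content ((g ` UNIV \<inter> cball (g t) h) - cone (g t) v a) / ennreal h) \<longlongrightarrow> 0) (at_right 0)"
  proof
    assume "((\<lambda>h. H1_content ((g ` UNIV \<inter> cball (g t) h) - cone (g t) v a) / ennreal h) \<longlongrightarrow> 0) (at_right 0)"
    then have "\<forall>\<^sub>F h in at_right 0. H1_content ((g ` UNIV \<inter> cball (g t) h) - cone (g t) v a) / ennreal h < ennreal (c / 4)"
      by (rule order_tendstoD) (use c in auto)
    then obtain h0 where h0: "h0 > 0" and small: "\<And>h. 0 < h \<Longrightarrow> h < h0 \<Longrightarrow>
        H1_content ((g ` UNIV \<inter> cball (g t) h) - cone (g t) v a) / ennreal h < ennreal (c / 4)"
      unfolding eventually_at_right_field by blast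
    have "isCont g t" using cont by (simp add: continuous_on_eq_continuous_at)
    then obtain e where e: "e > 0" "\<And>x. dist x t < e \<Longrightarrow> dist (g x) (g t) < h0 / 2"
      unfolding continuous_at_eps_delta using h0 by (metis half_gt_zero)
    obtain s where s: "\<bar>s\<bar> < e" "g (t + s) \<noteq> g t"
       "c * norm (g (t + s) - g t) \<le> \<bar>(\<i> * v) \<bullet> (g (t + s) - g t)\<bar>"
      using freq[OF e(1)] by auto
    define y where "y u = g (t + u * s) - g t" for u
    define r where "r = norm (y 1)"
    define f where "f u = \<bar>(\<i> * v) \<bullet> y u\<bar>" for u
    have r: "r > 0" "2 * r < h0" "c * r \<le> f 1"
      using s e(2)[of "t + s"] by (auto simp: r_def y_def f_def dist_norm)
    have conty: "continuous_on UNIV y" unfolding y_def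
      by (intro continuous_intros continuous_on_compose2[OF cont]) auto
    have contf: "continuous_on UNIV f" unfolding f_def by (intro continuous_intros conty)
    define F where "F = (g ` UNIV \<inter> cball (g t) (2 * r)) - cone (g t) v a"
    \<comment> \<open>The last time before \<open>g (t + s)\<close> at which the curve is close to the axis of the cone or far from \<open>g t\<close>:
      the arc after it avoids the cone, stays in the ball of radius \<open>2 * r\<close> and has diameter comparable to \<open>r\<close>.\<close>
    define A where "A = {u \<in> {0..1}. f u \<le> c * r / 2} \<union> {u \<in> {0..1}. norm (y u) \<ge> 2 * r}"
    have "A = {0..1} \<inter> ({u. f u \<le> c * r / 2} \<union> {u. norm (y u) \<ge> 2 * r})" by (auto simp: A_def)
    moreover have "closed {u. f u \<le> c * r / 2}" "closed {u. norm (y u) \<ge> 2 * r}"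
      by (intro closed_Collect_le continuous_intros contf conty)+
    ultimately have "closed A" by auto
    moreover have "A \<subseteq> {0..1}" by (auto simp: A_def)
    ultimately have "compact A"
      using compact_Int_closed[of "{0..1}" A] by (simp add: Int_absorb1)
    moreover have "0 \<in> A" using c r by (auto simp: A_def f_def y_def)
    ultimately obtain u0 where u0: "u0 \<in> A" "\<And>u. u \<in> A \<Longrightarrow> u \<le> u0"
      using compact_attains_sup[of A] by blast
    have "c * r / 2 < f 1" using r c mult_pos_pos[OF c r(1)] by linarith
    then have "1 \<notin> A" using r by (auto simp: A_def r_def[symmetric])
    then have u01: "0 \<le> u0" "u0 < 1" using u0(1) \<open>A \<subseteq> {0..1}\<close> by (force simp: order.order_iff_strict)+
    have inF: "g (t + u * s) \<in> F" if "u0 < u" "u \<le> 1" for u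
    proof -
      have "u \<notin> A" using u0(2) that by force
      then have u: "c * r / 2 < f u" "norm (y u) < 2 * r"
        using that u01 by (auto simp: A_def)
      have "k * norm (y u) < f u"
      proof -
        have "k * norm (y u) \<le> k * (2 * r)" using u k by (intro mult_left_mono) auto
        also have "\<dots> = c * r / 2" by (simp add: k_def)
        finally show ?thesis using u by simp
      qed
      then have "g (t + u * s) \<notin> cone (g t) v a"
        unfolding a_def by (intro not_in_cone v k) (auto simp: y_def f_def)
      then show ?thesis using u by (auto simp: F_def y_def dist_norm norm_minus_commute)
    qed
    \<comment> \<open>The arc starts either at transverse component at most
      \<open>c * r / 2\<close>, which then has to grow to \<open>c * r\<close>, or at distance at
      least \<open>2 * r\<close>, which then has to shrink to \<open>r\<close>. In both cases a
      1-Lipschitz function sweeps out an interval. The interval is open because the point at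
      \<open>u0\<close> itself is not known to lie in \<open>F\<close>.\<close>
    have "ennreal (c * r / 2) \<le> H1_content F"
    proof (cases "f u0 \<le> c * r / 2")
      case True
      have "{c * r / 2<..<c * r} \<subseteq> (\<lambda>z. \<bar>(\<i> * v) \<bullet> (z - g t)\<bar>) ` F"
      proof
        fix x assume x: "x \<in> {c * r / 2<..<c * r}"
        have "\<exists>u\<ge>u0. u \<le> 1 \<and> f u = x"
          by (rule IVT'[of f]) (use x True r u01 in \<open>auto intro: continuous_on_subset[OF contf]\<close>)
        then obtain u where u: "u0 \<le> u" "u \<le> 1" "f u = x" by blast
        with x True have "u0 < u" by (cases "u = u0") auto
        then show "x \<in> (\<lambda>z. \<bar>(\<i> * v) \<bullet> (z - g t)\<bar>) ` F"
          using inF[of u] u by (auto simp: f_def y_def image_iff intro!: bexI[of _ "g (t + u * s)"])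
      qed
      then have "ennreal (c * r - c * r / 2) \<le> H1_content F"
      proof (rule H1_content_ge_length[rotated])
        fix x y
        have "\<bar>\<bar>(\<i> * v) \<bullet> (x - g t)\<bar> - \<bar>(\<i> * v) \<bullet> (y - g t)\<bar>\<bar> \<le> \<bar>(\<i> * v) \<bullet> (x - y)\<bar>"
          by (simp add: inner_diff_right)
        then show "\<bar>\<bar>(\<i> * v) \<bullet> (x - g t)\<bar> - \<bar>(\<i> * v) \<bullet> (y - g t)\<bar>\<bar> \<le> norm (x - y)"
          using inner_le[of "x - y"] by linarith
      qed
      then show ?thesis by simp
    next
      case False
      then have b: "norm (y u0) \<ge> 2 * r" using u0(1) by (auto simp: A_def)
      have "{r<..<2 * r} \<subseteq> (\<lambda>z. norm (z - g t)) ` F"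
      proof
        fix x assume x: "x \<in> {r<..<2 * r}"
        have "\<exists>u\<ge>u0. u \<le> 1 \<and> norm (y u) = x"
          by (rule IVT2'[of "\<lambda>u. norm (y u)"]) (use x b r u01 in \<open>auto simp: r_def intro!: continuous_intros continuous_on_subset[OF conty]\<close>)
        then obtain u where u: "u0 \<le> u" "u \<le> 1" "norm (y u) = x" by blast
        with x b have "u0 < u" by (cases "u = u0") auto
        then show "x \<in> (\<lambda>z. norm (z - g t)) ` F"
          using inF[of u] u by (auto simp: y_def image_iff intro!: bexI[of _ "g (t + u * s)"])
      qed
      then have "ennreal (2 * r - r) \<le> H1_content F"
      proof (rule H1_content_ge_length[rotated])
        fix x y
        show "\<bar>norm (x - g t) - norm (y - g t)\<bar> \<le> norm (x - y)"
          using norm_triangle_ineq3[of "x - g t" "y - g t"] by simp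
      qed
      moreover have "c * r / 2 \<le> 2 * r - r" using c1 r c by (simp add: mult_le_cancel_right1)
      ultimately show ?thesis using ennreal_leI order_trans by blast
    qed
    then have "ennreal (c * r / 2) / ennreal (2 * r) \<le> H1_content F / ennreal (2 * r)"
      by (rule divide_right_mono_ennreal)
    moreover have "ennreal (c * r / 2) / ennreal (2 * r) = ennreal (c / 4)"
      using r c by (simp add: divide_ennreal)
    moreover have "H1_content F / ennreal (2 * r) < ennreal (c / 4)"
      unfolding F_def using r by (intro small) auto
    ultimately show False by auto
  qed
  with a show ?thesis by blast
qed

section \<open>Quadratic Gauss sums\<close>

text \<open>The linear coefficient \<open>m\<close> is the frequency that Poisson summation attaches
  to the residue \<open>r\<close>; the main term of the asymptotics involves only
  \<open>m = 0\<close>.\<close>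

definition quadratic_gauss_sum :: "int \<Rightarrow> nat \<Rightarrow> int \<Rightarrow> complex" where
  "quadratic_gauss_sum p q m = (\<Sum>r\<in>{0..<int q}. cis (2 * pi * of_int (m * r - p * r\<^sup>2) / real q))"

lemma cis_2pi_div_cong:
  fixes a b :: int
  assumes "q > 0" and "[a = b] (mod int q)"
  shows "cis (2 * pi * of_int a / real q) = cis (2 * pi * of_int b / real q)"
proof -
  obtain k where k: "a = b + int q * k"
    using assms(2) by (metis cong_iff_lin mult.commute cong_sym)
  have "2 * pi * of_int a / real q = 2 * pi * of_int b / real q + 2 * pi * of_int k"
    using assms(1) by (simp add: k field_simps)
  then show ?thesis by (simp flip: cis_mult)
qed

lemma sum_cis_2pi_div:
  fixes a :: int
  assumes q: "q > 0"
  shows "(\<Sum>r\<in>{0..<int q}. cis (2 * pi * of_int (a * r) / real q)) = (if int q dvd a then of_nat q else 0)"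
proof -
  define w where "w = cis (2 * pi * of_int a / real q)"
  have eq: "(\<Sum>r\<in>{0..<int q}. cis (2 * pi * of_int (a * r) / real q)) = (\<Sum>r<q. w ^ r)"
  proof (rule sum.reindex_bij_witness[of _ int nat])
    fix r assume "r \<in> {0..<int q}"
    then have "real (nat r) * (2 * pi * of_int a / real q) = 2 * pi * of_int (a * r) / real q" by simp
    then show "w ^ nat r = cis (2 * pi * of_int (a * r) / real q)"
      by (simp only: w_def Complex.DeMoivre)
  qed auto
  show ?thesis
  proof (cases "int q dvd a")
    case True
    then have "w = cis (2 * pi * of_int 0 / real q)"
      unfolding w_def by (intro cis_2pi_div_cong q) (auto simp: cong_0_iff)
    then show ?thesis using True unfolding eq by simp
  next
    case False
    have "w \<noteq> 1"
    proof
      assume "w = 1"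
      then obtain n :: int where "2 * pi * of_int a / real q = 2 * pi * of_int n"
        unfolding w_def by (auto simp: complex_eq_iff cos_one_2pi_int sin_times_pi_eq_0 elim!: exE)
      then have "real_of_int a = real_of_int (n * int q)" using q by (simp add: field_simps)
      then have "a = n * int q" by linarith
      then show False using False by simp
    qed
    moreover have "w ^ q = 1"
      using q by (simp add: w_def Complex.DeMoivre)
    ultimately show ?thesis using False unfolding eq by (simp add: geometric_sum)
  qed
qed

lemma sum_periodic_shift:
  fixes f :: "int \<Rightarrow> 'a :: comm_monoid_add"
  assumes "q > 0" and per: "\<And>a b. [a = b] (mod int q) \<Longrightarrow> f a = f b"
  shows "(\<Sum>r\<in>{0..<int q}. f (r + d)) = (\<Sum>r\<in>{0..<int q}. f r)"
proof (rule sum.reindex_bij_witness[of _ "\<lambda>r. (r - d) mod int q" "\<lambda>r. (r + d) mod int q"])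
  fix r assume "r \<in> {0..<int q}"
  then show "((r + d) mod int q - d) mod int q = r" "((r - d) mod int q + d) mod int q = r"
    by (simp_all add: mod_simps)
  show "f ((r + d) mod int q) = f (r + d)" by (rule per) (simp add: cong_def)
qed (use assms in auto)

text \<open>Shifting the summation variable of one factor by that of the other cancels the squares.
  What remains is, for each difference \<open>d\<close>, a sum of the linear character with
  frequency \<open>- 2 * p * d\<close>, which vanishes unless q divides
  \<open>2 * d\<close>.\<close>

lemma quadratic_gauss_sum_norm_sq:
  assumes q: "q > 0" and cop: "coprime p (int q)"
  shows "quadratic_gauss_sum p q m * cnj (quadratic_gauss_sum p q m) =
     of_nat q * (\<Sum>d | d \<in> {0..<int q} \<and> int q dvd 2 * d. cis (2 * pi * of_int (m * d - p * d\<^sup>2) / real q))"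
proof -
  define E where "E a = cis (2 * pi * of_int a / real q)" for a :: int
  define F where "F r = E (m * r - p * r\<^sup>2)" for r
  have E: "E a * E b = E (a + b)" "cnj (E a) = E (- a)" for a b
    by (simp_all add: E_def cis_mult cis_cnj add_divide_distrib ring_distribs)
  have Eper: "E a = E b" if "[a = b] (mod int q)" for a b
    unfolding E_def using cis_2pi_div_cong[OF q that] .
  have Fper: "F a = F b" if "[a = b] (mod int q)" for a b
    unfolding F_def by (rule Eper) (intro cong_diff cong_mult cong_pow cong_refl that)
  have G: "quadratic_gauss_sum p q m = (\<Sum>r\<in>{0..<int q}. F r)"
    by (simp add: quadratic_gauss_sum_def F_def E_def)
  have "quadratic_gauss_sum p q m * cnj (quadratic_gauss_sum p q m)
      = (\<Sum>r\<in>{0..<int q}. (\<Sum>d\<in>{0..<int q}. F d) * cnj (F r))"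
    by (simp add: G sum_distrib_left)
  also have "\<dots> = (\<Sum>r\<in>{0..<int q}. (\<Sum>d\<in>{0..<int q}. F (d + r)) * cnj (F r))"
    using sum_periodic_shift[OF q, of F] Fper by simp
  also have "\<dots> = (\<Sum>r\<in>{0..<int q}. \<Sum>d\<in>{0..<int q}. F d * E (- 2 * p * d * r))"
    unfolding sum_distrib_right
    by (intro sum.cong refl) (simp add: F_def E power2_eq_square algebra_simps)
  also have "\<dots> = (\<Sum>d\<in>{0..<int q}. F d * (\<Sum>r\<in>{0..<int q}. E (- 2 * p * d * r)))"
    by (subst sum.swap) (simp add: sum_distrib_left)
  also have "\<dots> = (\<Sum>d\<in>{0..<int q}. if int q dvd 2 * d then of_nat q * F d else 0)"
  proof (rule sum.cong[OF refl])
    fix d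
    have "int q dvd - 2 * p * d \<longleftrightarrow> int q dvd p * (2 * d)"
      by (simp add: mult.commute mult.left_commute)
    also have "\<dots> \<longleftrightarrow> int q dvd 2 * d"
      using cop by (simp add: coprime_dvd_mult_right_iff coprime_commute)
    finally show "F d * (\<Sum>r\<in>{0..<int q}. E (- 2 * p * d * r)) = (if int q dvd 2 * d then of_nat q * F d else 0)"
      using sum_cis_2pi_div[OF q, of "- 2 * p * d"] by (simp add: E_def)
  qed
  also have "\<dots> = of_nat q * (\<Sum>d | d \<in> {0..<int q} \<and> int q dvd 2 * d. F d)"
    unfolding sum_distrib_left by (rule sum.mono_neutral_cong_right) auto
  finally show ?thesis by (simp add: F_def E_def)
qed

text \<open>Only the differences 0 and, for even q, q/2 survive in
  \<open>quadratic_gauss_sum_norm_sq\<close>. The two contributions may add up or cancel, so for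
  even q there is an upper bound but no lower one.\<close>

lemma norm_quadratic_gauss_sum_le:
  assumes q: "q > 0" and cop: "coprime p (int q)"
  shows "norm (quadratic_gauss_sum p q m) \<le> sqrt (2 * real q)"
proof -
  let ?D = "{d. d \<in> {0..<int q} \<and> int q dvd 2 * d}"
  have "?D \<subseteq> {0, int q div 2}"
  proof
    fix d assume d: "d \<in> ?D"
    then obtain k where k: "2 * d = int q * k" by (auto elim: dvdE)
    have "0 \<le> int q * k" using d k by auto
    moreover have "int q * k < int q * 2" unfolding k[symmetric] using d by auto
    ultimately have "k = 0 \<or> k = 1" using q by (auto simp: zero_le_mult_iff)
    then show "d \<in> {0, int q div 2}" using k by auto
  qed
  then have "card ?D \<le> card {0, int q div 2}" by (rule card_mono[rotated]) simp
  also have "\<dots> \<le> 2" by (simp add: card_insert_if)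
  finally have card: "card ?D \<le> 2" .
  have "(norm (quadratic_gauss_sum p q m))\<^sup>2 = norm (quadratic_gauss_sum p q m * cnj (quadratic_gauss_sum p q m))"
    by (simp add: norm_mult power2_eq_square)
  also have "\<dots> = real q * norm (\<Sum>d\<in>?D. cis (2 * pi * of_int (m * d - p * d\<^sup>2) / real q))"
    by (simp add: quadratic_gauss_sum_norm_sq[OF assms] norm_mult)
  also have "\<dots> \<le> real q * 2"
    using card by (intro mult_left_mono order_trans[OF norm_sum]) auto
  finally show ?thesis by (simp add: real_le_rsqrt mult.commute)
qed

lemma norm_quadratic_gauss_sum_odd:
  assumes q: "odd q" and cop: "coprime p (int q)"
  shows "norm (quadratic_gauss_sum p q m) = sqrt (real q)"
proof -
  have q0: "q > 0" using q by (auto intro: odd_pos)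
  have "{d. d \<in> {0..<int q} \<and> int q dvd 2 * d} = {0}"
  proof -
    have "d = 0" if "d \<in> {0..<int q}" "int q dvd 2 * d" for d
    proof -
      have "int q dvd d" using that(2) q by (simp add: coprime_dvd_mult_right_iff)
      then show ?thesis using that(1) zdvd_not_zless[of d "int q"] by (cases "d = 0") auto
    qed
    then show ?thesis using q0 by auto
  qed
  then have "quadratic_gauss_sum p q m * cnj (quadratic_gauss_sum p q m) = of_nat q"
    by (simp add: quadratic_gauss_sum_norm_sq[OF q0 cop])
  then have "norm (quadratic_gauss_sum p q m * cnj (quadratic_gauss_sum p q m)) = real q" by simp
  then have "(norm (quadratic_gauss_sum p q m))\<^sup>2 = real q"
    by (simp add: norm_mult power2_eq_square)
  then show ?thesis by (metis norm_ge_zero real_sqrt_unique)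
qed

section \<open>Poisson summation for Gaussians\<close>

text \<open>A majorant of the functions themselves controls the derivatives as well, since locally
  uniform limits of holomorphic functions may be differentiated termwise. The second conclusion
  later supplies the summability of series that are only known as termwise derivatives.\<close>

lemma has_field_derivative_infsum:
  fixes f :: "'i \<Rightarrow> complex \<Rightarrow> complex"
  assumes S: "open S" "z \<in> S"
    and der: "\<And>i w. i \<in> I \<Longrightarrow> w \<in> S \<Longrightarrow> (f i has_field_derivative f' i w) (at w)"
    and bound: "\<And>i w. i \<in> I \<Longrightarrow> w \<in> S \<Longrightarrow> norm (f i w) \<le> M i"
    and M: "M summable_on I"
  shows "((\<lambda>w. \<Sum>\<^sub>\<infinity>i\<in>I. f i w) has_field_derivative (\<Sum>\<^sub>\<infinity>i\<in>I. f' i z)) (at z)" (is ?A)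
    and "(\<lambda>i. f' i z) summable_on I" (is ?B)
proof -
  obtain r where r: "r > 0" "cball z r \<subseteq> S" using S open_contains_cball by blast
  have ul: "uniform_limit (cball z r) (\<lambda>X w. \<Sum>i\<in>X. f i w) (\<lambda>w. \<Sum>\<^sub>\<infinity>i\<in>I. f i w) (finite_subsets_at_top I)"
    by (rule Weierstrass_m_test_general[OF _ M]) (use bound r in auto)
  have cont: "\<forall>\<^sub>F X in finite_subsets_at_top I. continuous_on (cball z r) (\<lambda>w. \<Sum>i\<in>X. f i w) \<and>
      (\<forall>w\<in>ball z r. ((\<lambda>w. \<Sum>i\<in>X. f i w) has_field_derivative (\<Sum>i\<in>X. f' i w)) (at w))"
  proof (rule eventually_finite_subsets_at_top_weakI)
    fix X assume X: "finite X" "X \<subseteq> I"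
    have d: "((\<lambda>w. \<Sum>i\<in>X. f i w) has_field_derivative (\<Sum>i\<in>X. f' i w)) (at w)" if "w \<in> S" for w
      by (rule DERIV_sum) (use der that X in auto)
    then have "continuous_on S (\<lambda>w. \<Sum>i\<in>X. f i w)"
      by (meson DERIV_isCont continuous_at_imp_continuous_on)
    then show "continuous_on (cball z r) (\<lambda>w. \<Sum>i\<in>X. f i w) \<and>
      (\<forall>w\<in>ball z r. ((\<lambda>w. \<Sum>i\<in>X. f i w) has_field_derivative (\<Sum>i\<in>X. f' i w)) (at w))"
      using d subset_trans[OF ball_subset_cball r(2)] r(2) by (metis continuous_on_subset subsetD)
  qed
  obtain g' where g': "\<And>w. w \<in> ball z r \<Longrightarrow>
      ((\<lambda>w. \<Sum>\<^sub>\<infinity>i\<in>I. f i w) has_field_derivative g' w) (at w) \<and>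
      ((\<lambda>X. \<Sum>i\<in>X. f' i w) \<longlongrightarrow> g' w) (finite_subsets_at_top I)"
    by (rule has_complex_derivative_uniform_limit[OF cont ul finite_subsets_at_top_neq_bot r(1)]) blast
  have "((\<lambda>i. f' i z) has_sum g' z) I"
    using g'[of z] r by (simp add: has_sum_def)
  then show ?B and ?A using g'[of z] r by (auto simp: summable_on_def infsumI)
qed

section \<open>Summability over the integers and exhaustion by intervals\<close>

lemma summable_on_norm_bound:
  fixes f :: "'a \<Rightarrow> 'b :: banach"
  assumes "g summable_on A" and "\<And>x. x \<in> A \<Longrightarrow> norm (f x) \<le> g x"
  shows "f summable_on A"
  using Infinite_Sum.abs_summable_on_comparison_test'[OF assms] by (rule abs_summable_summable)

lemma summable_on_inverse_square_int: "(\<lambda>k::int. 1 / (real_of_int k)\<^sup>2) summable_on A"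
proof -
  have "summable (\<lambda>n. norm (1 / (real n)\<^sup>2))"
    using inverse_power_summable[of 2, where 'a = real] by (simp add: divide_inverse power_inverse)
  then have n: "(\<lambda>n::nat. 1 / (real n)\<^sup>2) summable_on B" for B
    using norm_summable_imp_summable_on summable_on_subset subset_UNIV by (metis summable_on_subset_banach)
  have "(\<lambda>k::int. 1 / (real_of_int k)\<^sup>2) summable_on {0..}"
    using n[of UNIV] by (subst summable_on_reindex_bij_witness[of _ int nat UNIV "\<lambda>n. 1 / (real n)\<^sup>2"]) auto
  moreover have "(\<lambda>k::int. 1 / (real_of_int k)\<^sup>2) summable_on {..<0}"
    using n[of "{0<..}"] by (subst summable_on_reindex_bij_witness[of _ "\<lambda>n. - int n" "\<lambda>k. nat (- k)" "{0<..}" "\<lambda>n. 1 / (real n)\<^sup>2"]) auto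
  ultimately have "(\<lambda>k::int. 1 / (real_of_int k)\<^sup>2) summable_on ({0..} \<union> {..<0})"
    by (rule summable_on_Un_disjoint) auto
  then show ?thesis using summable_on_subset_banach by fastforce
qed

lemma summable_on_exp_square_int:
  assumes c: "c > 0"
  shows "(\<lambda>k::int. exp (- c * (real_of_int k)\<^sup>2)) summable_on A"
proof -
  have "(\<lambda>k::int. exp (- c * (real_of_int k)\<^sup>2)) summable_on (UNIV - {0})"
  proof (rule summable_on_comparison_test)
    show "(\<lambda>k::int. (1 / c) * (1 / (real_of_int k)\<^sup>2)) summable_on (UNIV - {0})"
      by (intro summable_on_cmult_right summable_on_inverse_square_int)
    fix k :: int assume "k \<in> UNIV - {0}"
    then have "0 < c * (real_of_int k)\<^sup>2" using c by simp
    moreover have "c * (real_of_int k)\<^sup>2 \<le> exp (c * (real_of_int k)\<^sup>2)"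
      using exp_ge_add_one_self[of "c * (real_of_int k)\<^sup>2"] by linarith
    ultimately have "inverse (exp (c * (real_of_int k)\<^sup>2)) \<le> inverse (c * (real_of_int k)\<^sup>2)"
      by (intro le_imp_inverse_le)
    then show "exp (- c * (real_of_int k)\<^sup>2) \<le> 1 / c * (1 / (real_of_int k)\<^sup>2)"
      by (simp add: exp_minus divide_inverse)
  qed auto
  then have "(\<lambda>k::int. exp (- c * (real_of_int k)\<^sup>2)) summable_on insert 0 (UNIV - {0})"
    by (simp only: summable_on_insert_iff)
  then show ?thesis using summable_on_subset_banach by fastforce
qed

text \<open>The closed intervals serve the symmetric partial sums of a Fourier series. The half-open
  ones index the unit intervals \<open>{j..j + 1}\<close> that tile \<open>{- n..n}\<close>.\<close>

lemma filterlim_int_intervals: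
  "filterlim (\<lambda>n. {- int n..int n}) (finite_subsets_at_top UNIV) sequentially"
  "filterlim (\<lambda>n. {- int n..<int n}) (finite_subsets_at_top UNIV) sequentially"
proof -
  have *: "\<forall>\<^sub>F n in sequentially. X \<subseteq> {- int n..<int n}" if X: "finite X" for X :: "int set"
  proof -
    have "\<forall>\<^sub>F n in sequentially. \<forall>x\<in>X. x \<in> {- int n..<int n}"
    proof (intro eventually_ball_finite ballI X)
      fix x :: int
      show "\<forall>\<^sub>F n in sequentially. x \<in> {- int n..<int n}"
        using eventually_gt_at_top[of "nat \<bar>x\<bar>"] by eventually_elim auto
    qed
    then show ?thesis by eventually_elim auto
  qed
  show "filterlim (\<lambda>n. {- int n..<int n}) (finite_subsets_at_top UNIV) sequentially"
    unfolding filterlim_finite_subsets_at_top using * by auto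
  show "filterlim (\<lambda>n. {- int n..int n}) (finite_subsets_at_top UNIV) sequentially"
    unfolding filterlim_finite_subsets_at_top
  proof (intro allI impI)
    fix X :: "int set" assume X: "finite X \<and> X \<subseteq> UNIV"
    show "\<forall>\<^sub>F n in sequentially. finite {- int n..int n} \<and> X \<subseteq> {- int n..int n} \<and> {- int n..int n} \<subseteq> UNIV"
      using *[OF conjunct1[OF X]] by eventually_elim force
  qed
qed

text \<open>One integration by parts against the exponential gains the factor 1/|k|. The boundary
  values \<open>h 0\<close> and \<open>h 1\<close> may differ, so both enter the constant.\<close>

lemma Riemann_Lebesgue_holomorphic:
  fixes h :: "complex \<Rightarrow> complex"
  assumes S: "open S" "of_real ` {0..1} \<subseteq> S" and h: "h holomorphic_on S"
  obtains C where "\<And>k::int. norm (integral {0..1} (\<lambda>x. h (of_real x) * cis (- 2 * pi * of_int k * x))) * \<bar>of_int k\<bar> \<le> C"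
proof -
  have S1: "of_real x \<in> S" if "x \<in> {0..1}" for x :: real using S that by auto
  have dh: "(h has_field_derivative deriv h w) (at w)" if "w \<in> S" for w
    using h S that by (simp add: holomorphic_derivI)
  have dhr: "((\<lambda>x. h (of_real x)) has_vector_derivative deriv h (of_real x)) (at x)" if "x \<in> {0..1}" for x
    using has_vector_derivative_real_field[OF dh[OF S1[OF that]]] .
  have conth: "continuous_on {0..1} (\<lambda>x. h (of_real x))"
    by (intro continuous_on_compose2[OF holomorphic_on_imp_continuous_on[OF h]] continuous_intros) (use S in auto)
  have contdh: "continuous_on {0..1} (\<lambda>x. deriv h (of_real x))"
    by (intro continuous_on_compose2[OF holomorphic_on_imp_continuous_on[OF holomorphic_deriv[OF h S(1)]]] continuous_intros) (use S in auto)
  then have "compact ((\<lambda>x. deriv h (of_real x)) ` {0..1})"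
    by (intro compact_continuous_image) auto
  then obtain B where B: "\<And>x. x \<in> {0..1} \<Longrightarrow> norm (deriv h (of_real x)) \<le> B"
    by (meson bounded_iff compact_imp_bounded imageI)
  show ?thesis
  proof (rule that[of "norm (h 1) + norm (h 0) + B"])
    fix k :: int
    show "norm (integral {0..1} (\<lambda>x. h (of_real x) * cis (- 2 * pi * of_int k * x))) * \<bar>of_int k\<bar> \<le> norm (h 1) + norm (h 0) + B"
    proof (cases "k = 0")
      case True
      have "0 \<le> norm (h 1) + norm (h 0) + B"
        using order_trans[OF norm_ge_zero B[of 0]] by simp
      with True show ?thesis by simp
    next
      case False
      define a where "a = - 2 * pi * of_int k"
      have a: "a \<noteq> 0" using False by (simp add: a_def)
      define E where "E x = cis (a * x) / (\<i> * of_real a)" for x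
      have dE: "(E has_vector_derivative cis (a * x)) (at x)" for x
      proof -
        have "((\<lambda>z. exp (\<i> * of_real a * z) / (\<i> * of_real a)) has_field_derivative exp (\<i> * of_real a * of_real x)) (at (of_real x))"
          using a by (auto intro!: derivative_eq_intros)
        from has_vector_derivative_real_field[OF this] show ?thesis
          by (simp add: E_def[abs_def] cis_conv_exp mult.assoc)
      qed
      have contE: "continuous_on {0..1} E" unfolding E_def by (intro continuous_intros) (use a in auto)
      define J where "J = integral {0..1} (\<lambda>x. deriv h (of_real x) * E x)"
      have "((\<lambda>x. deriv h (of_real x) * E x) has_integral J) {0..1}"
        unfolding J_def by (intro integrable_integral integrable_continuous_interval continuous_intros contdh contE)
      then have J: "((\<lambda>x. E x * deriv h (of_real x)) has_integral (E 1 * h 1 - E 0 * h 0 - (E 1 * h 1 - E 0 * h 0 - J))) {0..1}"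
        by (simp add: mult.commute)
      have "((\<lambda>x. cis (a * x) * h (of_real x)) has_integral (E 1 * h 1 - E 0 * h 0 - J)) {0..1}"
        by (rule integration_by_parts[OF bounded_bilinear_mult _ contE conth dE dhr]) (use J in auto)
      then have I: "integral {0..1} (\<lambda>x. h (of_real x) * cis (a * x)) = E 1 * h 1 - E 0 * h 0 - J"
        by (simp add: mult.commute integral_unique)
      have nE: "norm (E x) = 1 / \<bar>a\<bar>" for x by (simp add: E_def norm_divide norm_mult)
      have "norm J \<le> (B * (1 / \<bar>a\<bar>)) * (1 - 0)" unfolding J_def
      proof (rule integral_bound)
        show "norm (deriv h (of_real x) * E x) \<le> B * (1 / \<bar>a\<bar>)" if "x \<in> {0..1}" for x
          unfolding norm_mult nE by (intro mult_right_mono B that) simp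
      qed (auto intro!: continuous_intros contdh contE)
      then have "norm (E 1 * h 1 - E 0 * h 0 - J) \<le> 1 / \<bar>a\<bar> * norm (h 1) + 1 / \<bar>a\<bar> * norm (h 0) + B * (1 / \<bar>a\<bar>)"
        using norm_triangle_ineq4[of "E 1 * h 1 - E 0 * h 0" J] norm_triangle_ineq4[of "E 1 * h 1" "E 0 * h 0"]
        by (simp add: norm_mult nE)
      then have "norm (E 1 * h 1 - E 0 * h 0 - J) * \<bar>a\<bar> \<le> norm (h 1) + norm (h 0) + B"
        using a by (simp add: field_simps)
      moreover have "\<bar>of_int k\<bar> \<le> \<bar>a\<bar>"
      proof -
        have "1 * \<bar>of_int k\<bar> \<le> (2 * pi) * \<bar>real_of_int k\<bar>" using pi_ge_two by (intro mult_right_mono) auto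
        then show ?thesis by (simp add: a_def abs_mult)
      qed
      ultimately have "norm (E 1 * h 1 - E 0 * h 0 - J) * \<bar>of_int k\<bar> \<le> norm (h 1) + norm (h 0) + B"
        by (meson mult_left_mono norm_ge_zero order_trans)
      then show ?thesis using I by (simp add: a_def)
    qed
  qed
qed

text \<open>Chernoff's argument: dividing by \<open>exp (2 * pi * \<i> * z) - 1\<close> makes the partial sums of the Fourier series telescope.\<close>
lemma Fourier_series_sum_holomorphic:
  fixes f :: "complex \<Rightarrow> complex" and C :: complex
  defines "S \<equiv> {z. -1 < Re z \<and> Re z < 2 \<and> \<bar>Im z\<bar> < 1}"
  assumes f: "f holomorphic_on S" and per: "f 1 = f 0"
    and C: "((\<lambda>m::int. integral {0..1} (\<lambda>x. f (of_real x) * cis (- 2 * pi * of_int m * x))) has_sum C) UNIV"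
  shows "C = f 0"
proof -
  have "S = {z. -1 < Re z} \<inter> {z. Re z < 2} \<inter> {z. -1 < Im z} \<inter> {z. Im z < 1}" by (auto simp: S_def)
  then have opS: "open S" by (auto intro!: open_Int open_halfspace_Re_gt open_halfspace_Re_lt open_halfspace_Im_gt open_halfspace_Im_lt)
  have S01: "of_real ` {0..1} \<subseteq> S" by (auto simp: S_def)
  \<comment> \<open>\<open>D\<close> vanishes exactly at the integers, and the rectangle
    \<open>S\<close> contains just two of them, 0 and 1.\<close>
  define D where "D z = exp (2 * pi * \<i> * z) - 1" for z
  have D0: "D z = 0 \<longleftrightarrow> z \<in> {0, 1}" if "z \<in> S" for z
  proof
    assume "D z = 0"
    then have "exp (2 * pi * \<i> * z) = 1" by (simp add: D_def)
    then obtain n :: int where n: "Im (2 * pi * \<i> * z) = of_int (2 * n) * pi" "Re (2 * pi * \<i> * z) = 0"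
      by (auto simp: exp_eq_1)
    then have "Im z = 0" "Re z = of_int n" by auto
    moreover from this have "n = 0 \<or> n = 1" using that by (auto simp: S_def)
    ultimately show "z \<in> {0, 1}" by (auto simp: complex_eq_iff)
  next
    assume "z \<in> {0, 1}"
    then show "D z = 0" by (auto simp: D_def exp_eq_1 intro: exI[of _ 1])
  qed
  \<comment> \<open>The quotient of \<open>f z - f 0\<close> by \<open>D z\<close> has removable
    singularities at both zeros of \<open>D\<close>: at 1 the numerator vanishes by
    \<open>per\<close>. The value filled in is the quotient of the derivatives, that of
    \<open>D\<close> being \<open>2 * pi * \<i>\<close> at either point.\<close>
  define h where "h z = (if z \<in> {0, 1} then deriv f z / (2 * pi * \<i>) else (f z - f 0) / D z)" for z
  have h: "h holomorphic_on S"
  proof (rule no_isolated_singularity'[of "{0, 1}"])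
    have "(\<lambda>z. (f z - f 0) / D z) holomorphic_on S - {0, 1}"
      unfolding D_def by (intro holomorphic_intros holomorphic_on_subset[OF f]) (use D0 in \<open>auto simp: D_def\<close>)
    then show "h holomorphic_on S - {0, 1}"
      by (rule holomorphic_transform) (auto simp: h_def)
    fix z0 :: complex assume z0: "z0 \<in> {0, 1}"
    then have z0S: "z0 \<in> S" by (auto simp: S_def)
    have "(f has_field_derivative deriv f z0) (at z0)" using f opS z0S by (simp add: holomorphic_derivI)
    then have l1: "((\<lambda>z. (f z - f z0) / (z - z0)) \<longlongrightarrow> deriv f z0) (at z0)"
      by (simp add: has_field_derivative_iff)
    have "(D has_field_derivative 2 * pi * \<i> * exp (2 * pi * \<i> * z0)) (at z0)"
      unfolding D_def by (auto intro!: derivative_eq_intros)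
    moreover have "exp (2 * pi * \<i> * z0) = 1" using D0[OF z0S] z0 by (simp add: D_def)
    ultimately have l2: "((\<lambda>z. (D z - D z0) / (z - z0)) \<longlongrightarrow> 2 * pi * \<i>) (at z0)"
      by (simp add: has_field_derivative_iff)
    have "((\<lambda>z. ((f z - f z0) / (z - z0)) / ((D z - D z0) / (z - z0))) \<longlongrightarrow> deriv f z0 / (2 * pi * \<i>)) (at z0)"
      by (intro tendsto_divide l1 l2) auto
    moreover have "\<forall>\<^sub>F z in at z0. ((f z - f z0) / (z - z0)) / ((D z - D z0) / (z - z0)) = h z"
    proof -
      have "\<forall>\<^sub>F z in at z0. z \<in> S - {0,1}"
        using eventually_at_in_open[of "S - ({0,1} - {z0})" z0] z0S opS
        by (auto simp: open_Diff finite_imp_closed elim!: eventually_mono)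
      then show ?thesis
      proof eventually_elim
        case (elim z)
        have "f z0 = f 0" "D z0 = 0" using z0 per D0[OF z0S] by auto
        with elim show ?case by (auto simp: h_def)
      qed
    qed
    ultimately have "(h \<longlongrightarrow> deriv f z0 / (2 * pi * \<i>)) (at z0)"
      by (rule Lim_transform_eventually)
    then show "(h \<longlongrightarrow> h z0) (at z0 within S)"
      using z0 by (auto simp: h_def intro: Lim_at_imp_Lim_at_within)
  qed (use opS in auto)
  have conth: "continuous_on {0..1} (\<lambda>x. h (of_real x))"
    by (intro continuous_on_compose2[OF holomorphic_on_imp_continuous_on[OF h]] continuous_intros) (use S01 in auto)
  define H where "H k = integral {0..1} (\<lambda>x. h (of_real x) * cis (- 2 * pi * of_int k * x))" for k :: int
  have Hint: "((\<lambda>x. h (of_real x) * cis (- 2 * pi * of_int k * x)) has_integral H k) {0..1}" for k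
    unfolding H_def by (intro integrable_integral integrable_continuous_interval continuous_intros conth)
  define c where "c m = integral {0..1} (\<lambda>x. f (of_real x) * cis (- 2 * pi * of_int m * x))" for m :: int
  \<comment> \<open>On the real axis \<open>f = f 0 + h * D\<close>, and the exponential contained
    in \<open>D\<close> shifts the frequency by one. Hence every coefficient is a difference of
    neighbouring values of \<open>H\<close>, plus the contribution of the constant
    \<open>f 0\<close> at frequency 0.\<close>
  have c: "c m = (if m = 0 then f 0 else 0) + H (m - 1) - H m" for m
  proof -
    have e: "((\<lambda>x. cis (- 2 * pi * of_int m * x)) has_integral (if m = 0 then 1 else 0)) {0..1}"
    proof (cases "m = 0")
      case True
      then show ?thesis using has_integral_const_real[of "1::complex" 0 1] by simp
    next
      case False
      define a where "a = - 2 * pi * of_int m"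
      have a: "a \<noteq> 0" using False by (simp add: a_def)
      have "((\<lambda>x. cis (a * x) / (\<i> * of_real a)) has_vector_derivative cis (a * x)) (at x within {0..1})" for x
      proof -
        have "((\<lambda>z. exp (\<i> * of_real a * z) / (\<i> * of_real a)) has_field_derivative exp (\<i> * of_real a * of_real x)) (at (of_real x))"
          using a by (auto intro!: derivative_eq_intros)
        from has_vector_derivative_real_field[OF this] show ?thesis
          by (auto simp: cis_conv_exp mult.assoc intro: has_vector_derivative_at_within)
      qed
      then have "((\<lambda>x. cis (a * x)) has_integral (cis (a * 1) / (\<i> * of_real a) - cis (a * 0) / (\<i> * of_real a))) {0..1}"
        by (intro fundamental_theorem_of_calculus) auto
      moreover have "cis a = 1" using cis_multiple_2pi[of "- of_int m"] by (simp add: a_def)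
      ultimately show ?thesis using False by (simp add: a_def)
    qed
    have "((\<lambda>x. f 0 * cis (- 2 * pi * of_int m * x) + h (of_real x) * cis (- 2 * pi * of_int (m - 1) * x)
        - h (of_real x) * cis (- 2 * pi * of_int m * x)) has_integral
        (f 0 * (if m = 0 then 1 else 0) + H (m - 1) - H m)) {0..1}"
      by (intro has_integral_add has_integral_diff Hint has_integral_mult_right e)
    moreover have "f 0 * cis (- 2 * pi * of_int m * x) + h (of_real x) * cis (- 2 * pi * of_int (m - 1) * x)
        - h (of_real x) * cis (- 2 * pi * of_int m * x) = f (of_real x) * cis (- 2 * pi * of_int m * x)"
      if x: "x \<in> {0..1}" for x
    proof -
      have xS: "of_real x \<in> S" using S01 x by auto
      have A: "f (of_real x) = f 0 + h (of_real x) * D (of_real x)"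
        using D0[OF xS] per by (cases "of_real x \<in> {0, 1::complex}") (auto simp: h_def)
      have B: "cis (- 2 * pi * of_int (m - 1) * x) = cis (- 2 * pi * of_int m * x) * cis (2 * pi * x)"
        by (simp add: cis_mult algebra_simps)
      have C: "D (of_real x) = cis (2 * pi * x) - 1"
        by (simp add: D_def cis_conv_exp mult_ac)
      show ?thesis unfolding A B C by (simp only: ring_distribs) (simp add: mult_ac)
    qed
    ultimately have "((\<lambda>x. f (of_real x) * cis (- 2 * pi * of_int m * x)) has_integral
        (f 0 * (if m = 0 then 1 else 0) + H (m - 1) - H m)) {0..1}"
      by (rule has_integral_eq[rotated])
    then show ?thesis by (auto simp: c_def dest: integral_unique)
  qed
  have sumc: "(\<Sum>m\<in>{- int n..int n}. c m) = f 0 + H (- 1 - int n) - H (int n)" for n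
  proof (induction n)
    case 0
    show ?case by (simp add: c)
  next
    case (Suc n)
    have "{- int (Suc n)..int (Suc n)} = insert (- int (Suc n)) (insert (int (Suc n)) {- int n..int n})"
      by auto
    then have "(\<Sum>m\<in>{- int (Suc n)..int (Suc n)}. c m) = c (- int (Suc n)) + (c (int (Suc n)) + (\<Sum>m\<in>{- int n..int n}. c m))"
      by simp
    then show ?case by (simp only: Suc.IH c[of "- int (Suc n)"] c[of "int (Suc n)"]) simp
  qed
  obtain B where B: "\<And>k. norm (H k) * \<bar>of_int k\<bar> \<le> B"
    using Riemann_Lebesgue_holomorphic[OF opS S01 h] unfolding H_def by metis
  have HB: "norm (H k) \<le> B / real n" if "\<bar>k\<bar> \<ge> int n" "n > 0" for k n
  proof -
    have "norm (H k) * real n \<le> norm (H k) * \<bar>of_int k\<bar>"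
      using that by (intro mult_left_mono norm_ge_zero) linarith
    also have "\<dots> \<le> B" by (rule B)
    finally show ?thesis using that by (simp add: pos_le_divide_eq)
  qed
  have lim: "(\<lambda>n. B / real n) \<longlonglongrightarrow> 0" by (rule lim_const_over_n)
  have "(\<lambda>n. H (- 1 - int n)) \<longlonglongrightarrow> 0"
    by (rule Lim_null_comparison[OF _ lim]) (use eventually_gt_at_top[of 0] in eventually_elim, intro HB, auto)
  moreover have "(\<lambda>n. H (int n)) \<longlonglongrightarrow> 0"
    by (rule Lim_null_comparison[OF _ lim]) (use eventually_gt_at_top[of 0] in eventually_elim, intro HB, auto)
  ultimately have "(\<lambda>n. f 0 + H (- 1 - int n) - H (int n)) \<longlonglongrightarrow> f 0 + 0 - 0"
    by (intro tendsto_intros)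
  then have "(\<lambda>n. \<Sum>m\<in>{- int n..int n}. c m) \<longlonglongrightarrow> f 0" by (simp add: sumc)
  moreover have "(\<lambda>n. \<Sum>m\<in>{- int n..int n}. c m) \<longlonglongrightarrow> C"
    using C filterlim_int_intervals(1) unfolding has_sum_def c_def[symmetric] by (rule filterlim_compose)
  ultimately show ?thesis using LIMSEQ_unique by blast
qed

text \<open>This is the characteristic function of the standard normal law after the substitution
  \<open>x = c * (a + y)\<close>; \<open>c = sqrt (2 * pi * \<tau>)\<close> turns
  \<open>exp (- x\<^sup>2 / 2)\<close> into the required Gaussian.\<close>

lemma has_bochner_integral_gaussian_cis:
  fixes a \<tau> :: real and m :: int
  assumes \<tau>: "\<tau> > 0"
  shows "has_bochner_integral lborel (\<lambda>y. of_real (exp (- pi * \<tau> * (a + y)\<^sup>2)) * cis (- 2 * pi * of_int m * y))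
          (cis (2 * pi * of_int m * a) * of_real (exp (- pi * (of_int m)\<^sup>2 / \<tau>) / sqrt \<tau>))"
proof -
  define c where "c = sqrt (2 * pi * \<tau>)"
  have c: "c > 0" "c\<^sup>2 = 2 * pi * \<tau>" using \<tau> by (auto simp: c_def)
  define s where "s = - 2 * pi * of_int m / c"
  have int: "integrable lborel (\<lambda>x. std_normal_density x *\<^sub>R iexp (s * x))"
    by (rule Bochner_Integration.integrable_bound[OF integrable_normal_density[of 1 0]]) auto
  have "(CLINT x|lborel. std_normal_density x *\<^sub>R iexp (s * x)) = char std_normal_distribution s"
    unfolding char_def by (subst integral_density) auto
  also have "\<dots> = of_real (exp (- (s\<^sup>2) / 2))" by (simp add: char_std_normal_distribution)
  also have "- (s\<^sup>2) / 2 = - (pi * (of_int m)\<^sup>2 / \<tau>)"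
  proof -
    have "s\<^sup>2 = 4 * pi\<^sup>2 * (of_int m)\<^sup>2 / c\<^sup>2" by (simp add: s_def power_divide power_mult_distrib)
    then show ?thesis unfolding c(2) using \<tau> by (simp add: field_simps power2_eq_square)
  qed
  finally have val: "(CLINT x|lborel. std_normal_density x *\<^sub>R iexp (s * x)) = of_real (exp (- (pi * (of_int m)\<^sup>2 / \<tau>)))" .
  have "has_bochner_integral lborel (\<lambda>x. std_normal_density x *\<^sub>R iexp (s * x)) (of_real (exp (- (pi * (of_int m)\<^sup>2 / \<tau>))))"
    using int val has_bochner_integral_iff by blast
  then have "has_bochner_integral lborel (\<lambda>y. std_normal_density (c * a + c * y) *\<^sub>R iexp (s * (c * a + c * y)))
      (of_real (exp (- (pi * (of_int m)\<^sup>2 / \<tau>))) /\<^sub>R \<bar>c\<bar>)"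
    by (subst (asm) lborel_has_bochner_integral_real_affine_iff[of c _ _ "c * a"]) (use c in auto)
  then have "has_bochner_integral lborel (\<lambda>y. (of_real (sqrt (2 * pi)) * cis (2 * pi * of_int m * a)) *
       (std_normal_density (c * a + c * y) *\<^sub>R iexp (s * (c * a + c * y))))
      ((of_real (sqrt (2 * pi)) * cis (2 * pi * of_int m * a)) * (of_real (exp (- (pi * (of_int m)\<^sup>2 / \<tau>))) /\<^sub>R \<bar>c\<bar>))"
    by (rule has_bochner_integral_mult_right) 
  moreover have "(of_real (sqrt (2 * pi)) * cis (2 * pi * of_int m * a)) *
       (std_normal_density (c * a + c * y) *\<^sub>R iexp (s * (c * a + c * y)))
      = of_real (exp (- pi * \<tau> * (a + y)\<^sup>2)) * cis (- 2 * pi * of_int m * y)" for y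
  proof -
    have "(c * a + c * y)\<^sup>2 = c\<^sup>2 * (a + y)\<^sup>2" by (simp add: power2_eq_square algebra_simps)
    then have "sqrt (2 * pi) * std_normal_density (c * a + c * y) = exp (- pi * \<tau> * (a + y)\<^sup>2)"
      by (simp add: std_normal_density_def c(2) mult_ac)
    then have 1: "of_real (sqrt (2 * pi)) * complex_of_real (std_normal_density (c * a + c * y)) = of_real (exp (- pi * \<tau> * (a + y)\<^sup>2))"
      by (simp only: of_real_mult[symmetric])
    have "s * (c * a + c * y) = - 2 * pi * of_int m * a + - 2 * pi * of_int m * y"
      using c(1) by (simp add: s_def field_simps)
    then have "iexp (s * (c * a + c * y)) = cis (- 2 * pi * of_int m * a) * cis (- 2 * pi * of_int m * y)"
      by (simp only: cis_conv_exp[symmetric] cis_mult)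
    then have 2: "cis (2 * pi * of_int m * a) * iexp (s * (c * a + c * y)) = cis (- 2 * pi * of_int m * y)"
      by (simp add: cis_mult)
    have "(of_real (sqrt (2 * pi)) * cis (2 * pi * of_int m * a)) *
       (std_normal_density (c * a + c * y) *\<^sub>R iexp (s * (c * a + c * y)))
      = (of_real (sqrt (2 * pi)) * complex_of_real (std_normal_density (c * a + c * y))) *
        (cis (2 * pi * of_int m * a) * iexp (s * (c * a + c * y)))"
      unfolding scaleR_conv_of_real by (simp only: mult_ac)
    then show ?thesis unfolding 1 2 .
  qed
  moreover have "(of_real (sqrt (2 * pi)) * cis (2 * pi * of_int m * a)) * (of_real (exp (- (pi * (of_int m)\<^sup>2 / \<tau>))) /\<^sub>R \<bar>c\<bar>)
     = cis (2 * pi * of_int m * a) * of_real (exp (- pi * (of_int m)\<^sup>2 / \<tau>) / sqrt \<tau>)"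
    using c(1) \<tau> by (simp add: scaleR_conv_of_real c_def real_sqrt_mult field_simps)
  ultimately show ?thesis by simp
qed

text \<open>The inequality (j + x)^2 \<ge> j^2 / 2 - x^2, with x = Re z, gives up half of the decay
  in \<open>j\<close> in order to separate \<open>j\<close> from \<open>z\<close>. On bounded sets
  of \<open>z\<close> this yields one summable majorant.\<close>

lemma norm_gaussian_shift_le:
  fixes z :: complex and j :: int
  assumes "\<tau> > 0"
  shows "norm (exp (- of_real (pi * \<tau>) * (of_int j + z)\<^sup>2)) \<le> exp (pi * \<tau> * (norm z)\<^sup>2) * exp (- (pi * \<tau> / 2) * (of_int j)\<^sup>2)"
proof -
  have "Re ((of_int j + z)\<^sup>2) = (of_int j + Re z)\<^sup>2 - (Im z)\<^sup>2"
    by (simp add: power2_eq_square)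
  moreover have "(of_int j + Re z)\<^sup>2 - (of_int j)\<^sup>2 / 2 + (Re z)\<^sup>2 = (of_int j + 2 * Re z)\<^sup>2 / 2"
    by (simp add: power2_eq_square algebra_simps)
  moreover have "(norm z)\<^sup>2 = (Re z)\<^sup>2 + (Im z)\<^sup>2" by (rule cmod_power2)
  moreover have "0 \<le> (of_int j + 2 * Re z)\<^sup>2 / 2" by simp
  ultimately have "- Re ((of_int j + z)\<^sup>2) \<le> (norm z)\<^sup>2 - (of_int j)\<^sup>2 / 2" by linarith
  then have "(pi * \<tau>) * (- Re ((of_int j + z)\<^sup>2)) \<le> (pi * \<tau>) * ((norm z)\<^sup>2 - (of_int j)\<^sup>2 / 2)"
    using assms by (intro mult_left_mono) auto
  then show ?thesis
    by (simp add: exp_add[symmetric] algebra_simps)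
qed

text \<open>The sum of the integer translates of the Gaussian is holomorphic and takes equal values
  at 0 and 1, so its Fourier series, once summable, sums at 0 to its value there. The Gaussian decay
  of the coefficients provides the summability.\<close>

theorem Poisson_summation_gaussian:
  fixes a \<tau> :: real
  assumes \<tau>: "\<tau> > 0"
  shows "((\<lambda>m::int. cis (2 * pi * of_int m * a) * of_real (exp (- pi * (of_int m)\<^sup>2 / \<tau>) / sqrt \<tau>))
     has_sum (\<Sum>\<^sub>\<infinity>j::int. of_real (exp (- pi * \<tau> * (of_int j + a)\<^sup>2)))) UNIV"
proof -
  define u where "u j z = exp (- of_real (pi * \<tau>) * (of_int j + (of_real a + z))\<^sup>2)" for j :: int and z :: complex
  define f where "f z = (\<Sum>\<^sub>\<infinity>j. u j z)" for z
  define S where "S = {z. -1 < Re z \<and> Re z < 2 \<and> \<bar>Im z\<bar> < 1}"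
  have "S = {z. -1 < Re z} \<inter> {z. Re z < 2} \<inter> {z. -1 < Im z} \<inter> {z. Im z < 1}" by (auto simp: S_def)
  then have opS: "open S" by (auto intro!: open_Int open_halfspace_Re_gt open_halfspace_Re_lt open_halfspace_Im_gt open_halfspace_Im_lt)
  define M where "M j = exp (pi * \<tau> * (\<bar>a\<bar> + 3)\<^sup>2) * exp (- (pi * \<tau> / 2) * (of_int j)\<^sup>2)" for j :: int
  have M: "M summable_on UNIV"
    unfolding M_def using \<tau> by (intro summable_on_cmult_right summable_on_exp_square_int) auto
  have uM: "norm (u j z) \<le> M j" if "z \<in> S" for j z
  proof -
    have "norm (of_real a + z) \<le> \<bar>a\<bar> + (\<bar>Re z\<bar> + \<bar>Im z\<bar>)"
      by (rule order_trans[OF norm_triangle_ineq]) (use cmod_le[of z] in auto)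
    also have "\<dots> \<le> \<bar>a\<bar> + 3" using that by (auto simp: S_def)
    finally have "(norm (of_real a + z))\<^sup>2 \<le> (\<bar>a\<bar> + 3)\<^sup>2" by (rule power_mono) simp
    then show ?thesis unfolding u_def M_def
      using \<tau> by (intro order_trans[OF norm_gaussian_shift_le[OF \<tau>]] mult_right_mono) auto
  qed
  have der: "(u j has_field_derivative - of_real (pi * \<tau>) * (2 * (of_int j + (of_real a + z))) * u j z) (at z)" for j z
    unfolding u_def by (rule derivative_eq_intros refl | simp)+
  have f: "f holomorphic_on S"
    unfolding f_def[abs_def] holomorphic_on_open[OF opS]
    using has_field_derivative_infsum(1)[OF opS _ der uM M] by blast
  have per: "f 1 = f 0"
    unfolding f_def by (rule infsum_reindex_bij_witness[of _ "\<lambda>j. j - 1" "\<lambda>j. j + 1"]) (auto simp: u_def add_ac)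
  define c where "c m = integral {0..1} (\<lambda>x. f (of_real x) * cis (- 2 * pi * of_int m * x))" for m :: int
  \<comment> \<open>Unfolding: sum and integral over \<open>{0..1}\<close> are interchanged by
    uniform convergence, the translated unit intervals are glued to \<open>{- n..n}\<close>, and
    letting n tend to infinity gives the Fourier transform on the whole line.\<close>
  have c: "c m = cis (2 * pi * of_int m * a) * of_real (exp (- pi * (of_int m)\<^sup>2 / \<tau>) / sqrt \<tau>)" for m
  proof -
    define g where "g y = of_real (exp (- pi * \<tau> * (a + y)\<^sup>2)) * cis (- 2 * pi * of_int m * y)" for y
    have ug: "u j (of_real x) * cis (- 2 * pi * of_int m * x) = g (x + of_int j)" for j x
    proof -
      have "cis (- 2 * pi * of_int m * (x + of_int j)) = cis (- 2 * pi * of_int m * x) * cis (2 * pi * of_int (- m * j))"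
        by (simp add: cis_mult algebra_simps)
      also have "cis (2 * pi * of_int (- m * j)) = 1" by (rule cis_multiple_2pi) (auto simp del: of_int_mult)
      finally have "cis (- 2 * pi * of_int m * (x + of_int j)) = cis (- 2 * pi * of_int m * x)" by simp
      moreover have "u j (of_real x) = of_real (exp (- pi * \<tau> * (a + (x + of_int j))\<^sup>2))"
        unfolding u_def by (simp add: exp_of_real[symmetric] add_ac)
      ultimately show ?thesis unfolding g_def by simp
    qed
    have contg: "continuous_on A g" for A unfolding g_def by (intro continuous_intros)
    have contu: "continuous_on A (u j)" for A j
      unfolding u_def by (intro continuous_intros)
    have ul: "uniform_limit {0..1} (\<lambda>X x. \<Sum>j\<in>X. u j (of_real x) * cis (- 2 * pi * of_int m * x))
        (\<lambda>x. \<Sum>\<^sub>\<infinity>j. u j (of_real x) * cis (- 2 * pi * of_int m * x)) (finite_subsets_at_top UNIV)"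
      by (rule Weierstrass_m_test_general[OF _ M]) (auto simp: norm_mult S_def intro!: uM)
    obtain I J where I: "\<And>X. ((\<lambda>x. \<Sum>j\<in>X. u j (of_real x) * cis (- 2 * pi * of_int m * x)) has_integral I X) {0..1}"
      and J: "((\<lambda>x. \<Sum>\<^sub>\<infinity>j. u j (of_real x) * cis (- 2 * pi * of_int m * x)) has_integral J) {0..1}"
      and IJ: "(I \<longlongrightarrow> J) (finite_subsets_at_top UNIV)"
    proof (rule uniform_limit_integral[OF ul])
      show "continuous_on {0..1} (\<lambda>x. \<Sum>j\<in>X. u j (of_real x) * cis (- 2 * pi * of_int m * x))" for X
        by (intro continuous_intros continuous_on_compose2[OF contu[of UNIV]]) auto
    qed (auto intro: that)
    have "(\<Sum>\<^sub>\<infinity>j. u j (of_real x) * cis (- 2 * pi * of_int m * x)) = f (of_real x) * cis (- 2 * pi * of_int m * x)" for x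
      unfolding f_def by (rule infsum_cmult_left')
    with J have cJ: "c m = J" unfolding c_def by (simp add: integral_unique)
    have In: "I {- int n..<int n} = integral {- real n..real n} g" for n
    proof -
      have step: "((\<lambda>x. g (x + of_int j)) has_integral integral {of_int j..of_int j + 1} g) {0..1}" for j
      proof -
        have "(g has_integral integral {of_int j..of_int j + 1} g) {of_int j..of_int j + 1}"
          by (intro integrable_integral integrable_continuous_interval contg)
        then show ?thesis
          using has_integral_shift_Icc_real[of g "of_int j" _ 0 1] by (simp add: o_def add.commute)
      qed
      have "I X = (\<Sum>j\<in>X. integral {of_int j..of_int j + 1} g)" if "finite X" for X
      proof -
        have "((\<lambda>x. \<Sum>j\<in>X. g (x + of_int j)) has_integral (\<Sum>j\<in>X. integral {of_int j..of_int j + 1} g)) {0..1}"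
          by (intro has_integral_sum that step)
        then show ?thesis using I[of X] unfolding ug by (rule has_integral_unique[rotated])
      qed
      moreover have "(\<Sum>j\<in>{- int n..<int n}. integral {of_int j..of_int j + 1} g) = integral {- real n..real n} g"
      proof (induction n)
        case (Suc n)
        have gi: "g integrable_on {x..y}" for x y
          by (intro integrable_continuous_interval contg)
        have "{- int (Suc n)..<int (Suc n)} = insert (- int (Suc n)) (insert (int n) {- int n..<int n})" by auto
        then have "(\<Sum>j\<in>{- int (Suc n)..<int (Suc n)}. integral {of_int j..of_int j + 1} g)
           = integral {of_int (- int (Suc n))..of_int (- int (Suc n)) + 1} g
           + (integral {of_int (int n)..of_int (int n) + 1} g + integral {- real n..real n} g)"
          using Suc.IH by simp
        also have "\<dots> = integral {- real (Suc n)..- real n} g + (integral {- real n..real n} g + integral {real n..real (Suc n)} g)"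
          by (simp add: add_ac)
        also have "\<dots> = integral {- real (Suc n)..real (Suc n)} g"
          by (subst Henstock_Kurzweil_Integration.integral_combine; (simp add: gi)?)+
        finally show ?case .
      qed simp
      ultimately show ?thesis by simp
    qed
    have lim: "(\<lambda>n. integral {- real n..real n} g) \<longlonglongrightarrow> integral\<^sup>L lborel g"
    proof -
      have gi: "integrable lborel g" and
        "integral\<^sup>L lborel g = cis (2 * pi * of_int m * a) * of_real (exp (- pi * (of_int m)\<^sup>2 / \<tau>) / sqrt \<tau>)"
        using has_bochner_integral_gaussian_cis[OF \<tau>, of a m] unfolding g_def[abs_def, symmetric] has_bochner_integral_iff by auto
      have "(\<lambda>n. LINT x|lborel. indicator {- real n..real n} x *\<^sub>R g x) \<longlonglongrightarrow> integral\<^sup>L lborel g"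
      proof (rule integral_dominated_convergence[where w = "\<lambda>x. norm (g x)"])
        show "AE x in lborel. (\<lambda>n. indicator {- real n..real n} x *\<^sub>R g x) \<longlonglongrightarrow> g x"
        proof (rule AE_I2)
          fix x :: real
          have "\<forall>\<^sub>F n in sequentially. indicator {- real n..real n} x *\<^sub>R g x = g x"
            using eventually_ge_at_top[of "nat \<lceil>\<bar>x\<bar>\<rceil>"]
            by eventually_elim (auto simp: indicator_def split: if_splits; linarith)
          then show "(\<lambda>n. indicator {- real n..real n} x *\<^sub>R g x) \<longlonglongrightarrow> g x"
            by (rule tendsto_eventually)
        qed
      qed (use gi in \<open>auto simp: indicator_def\<close>)
      moreover have "(LINT x|lborel. indicator {- real n..real n} x *\<^sub>R g x) = integral {- real n..real n} g" for n
      proof -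
        have "set_integrable lborel {- real n..real n} g"
          unfolding set_integrable_def using gi by (intro integrable_mult_indicator) auto
        from set_borel_integral_eq_integral(2)[OF this] show ?thesis by (simp add: set_lebesgue_integral_def)
      qed
      ultimately show ?thesis by simp
    qed
    have "(\<lambda>n. I {- int n..<int n}) \<longlonglongrightarrow> J"
      using IJ filterlim_int_intervals(2) by (rule filterlim_compose)
    with lim have "J = integral\<^sup>L lborel g" unfolding In using LIMSEQ_unique by blast
    then show ?thesis using cJ has_bochner_integral_gaussian_cis[OF \<tau>, of a m]
      unfolding g_def[abs_def, symmetric] has_bochner_integral_iff by auto
  qed
  have "c summable_on UNIV"
  proof (rule abs_summable_summable)
    have "(\<lambda>m::int. 1 / sqrt \<tau> * exp (- (pi / \<tau>) * (of_int m)\<^sup>2)) summable_on UNIV"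
      using \<tau> by (intro summable_on_cmult_right summable_on_exp_square_int) auto
    moreover have "norm (c m) = 1 / sqrt \<tau> * exp (- (pi / \<tau>) * (of_int m)\<^sup>2)" for m
      using \<tau> by (simp add: c norm_mult norm_divide)
    ultimately show "(\<lambda>m. norm (c m)) summable_on UNIV" by simp
  qed
  then have hs: "(c has_sum infsum c UNIV) UNIV" by simp
  then have "infsum c UNIV = f 0"
    using Fourier_series_sum_holomorphic[of f "infsum c UNIV"] f per unfolding S_def c_def[abs_def] by blast
  moreover have "f 0 = (\<Sum>\<^sub>\<infinity>j::int. of_real (exp (- pi * \<tau> * (of_int j + a)\<^sup>2)))"
    unfolding f_def u_def by (rule infsum_cong) (simp add: exp_of_real[symmetric])
  ultimately show ?thesis using hs unfolding c[abs_def] by simp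
qed

section \<open>Asymptotics at rational points\<close>

text \<open>The curve consists of boundary values: \<open>phi t = phi_ext (\<i> * t)\<close>, and \<open>phi_ext\<close> is holomorphic on the right half-plane.\<close>
definition phi_ext :: "complex \<Rightarrow> complex" where
  "phi_ext w = w + (\<Sum>\<^sub>\<infinity>k\<in>UNIV - {0::int}. (1 - exp (- of_real (4 * pi\<^sup>2 * (of_int k)\<^sup>2) * w)) / of_real (4 * pi\<^sup>2 * (of_int k)\<^sup>2))"

lemma norm_phi_ext_term_le:
  fixes k :: int
  assumes "Re w \<ge> 0"
  shows "norm ((1 - exp (- of_real (4 * pi\<^sup>2 * (of_int k)\<^sup>2) * w)) / of_real (4 * pi\<^sup>2 * (of_int k)\<^sup>2)) \<le> 1 / (of_int k)\<^sup>2"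
proof (cases "k = 0")
  case False
  have "norm (1 - exp (- of_real (4 * pi\<^sup>2 * (of_int k)\<^sup>2) * w)) \<le> 1 + norm (exp (- of_real (4 * pi\<^sup>2 * (of_int k)\<^sup>2) * w))"
    by (rule order_trans[OF norm_triangle_ineq4]) simp
  also have "norm (exp (- of_real (4 * pi\<^sup>2 * (of_int k)\<^sup>2) * w)) \<le> 1"
    using assms by (auto simp: intro!: mult_nonneg_nonneg)
  finally have "norm (1 - exp (- of_real (4 * pi\<^sup>2 * (of_int k)\<^sup>2) * w)) \<le> 2" by simp
  moreover have "2 \<le> 4 * pi\<^sup>2" using pi_ge_two power_mono[of 2 pi 2] by simp
  ultimately have "norm (1 - exp (- of_real (4 * pi\<^sup>2 * (of_int k)\<^sup>2) * w)) \<le> 4 * pi\<^sup>2" by linarith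
  then show ?thesis
    using False by (simp add: norm_divide norm_mult norm_power field_simps)
qed simp

lemma phi_ext_summable:
  assumes "Re w \<ge> 0"
  shows "(\<lambda>k::int. (1 - exp (- of_real (4 * pi\<^sup>2 * (of_int k)\<^sup>2) * w)) / of_real (4 * pi\<^sup>2 * (of_int k)\<^sup>2)) summable_on A"
  using norm_phi_ext_term_le[OF assms] by (rule summable_on_norm_bound[OF summable_on_inverse_square_int])

lemma phi_eq_phi_ext: "phi t = phi_ext (\<i> * of_real t)"
proof -
  define u where "u k = (1 - exp (- of_real (4 * pi\<^sup>2 * (of_int k)\<^sup>2) * (\<i> * of_real t))) / of_real (4 * pi\<^sup>2 * (of_int k)\<^sup>2)" for k :: int
  have eq: "phi_term t k = u k" if "k \<noteq> 0" for k
  proof -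
    have "cis (- 4 * pi^2 * of_int k ^ 2 * t) = exp (- of_real (4 * pi\<^sup>2 * (of_int k)\<^sup>2) * (\<i> * of_real t))"
      by (simp add: cis_conv_exp mult_ac)
    then have "phi_term t k = (exp (- of_real (4 * pi\<^sup>2 * (of_int k)\<^sup>2) * (\<i> * of_real t)) - 1) / - of_real (4 * pi\<^sup>2 * (of_int k)\<^sup>2)"
      using that by (simp add: phi_term_def)
    also have "\<dots> = u k" unfolding u_def by (metis minus_diff_eq minus_divide_divide)
    finally show ?thesis .
  qed
  have "u summable_on (UNIV - {0})" unfolding u_def by (rule phi_ext_summable) simp
  then have "phi_term t summable_on (UNIV - {0})" using eq by (subst summable_on_cong[of _ _ u]) auto
  then have "(\<Sum>\<^sub>\<infinity>k\<in>insert 0 (UNIV - {0}). phi_term t k) = phi_term t 0 + (\<Sum>\<^sub>\<infinity>k\<in>UNIV - {0}. phi_term t k)"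
    by (intro infsum_insert) auto
  also have "(\<Sum>\<^sub>\<infinity>k\<in>UNIV - {0}. phi_term t k) = (\<Sum>\<^sub>\<infinity>k\<in>UNIV - {0}. u k)"
    using eq by (intro infsum_cong) auto
  also have "insert 0 (UNIV - {0}) = (UNIV :: int set)" by auto
  finally show ?thesis by (simp add: phi_def phi_ext_def u_def phi_term_def)
qed

lemma continuous_on_phi_ext: "continuous_on {w. Re w \<ge> 0} phi_ext"
proof -
  have "uniform_limit {w. Re w \<ge> 0} (\<lambda>X w. \<Sum>k\<in>X. (1 - exp (- of_real (4 * pi\<^sup>2 * (of_int k)\<^sup>2) * w)) / of_real (4 * pi\<^sup>2 * (of_int k)\<^sup>2))
     (\<lambda>w. \<Sum>\<^sub>\<infinity>k\<in>UNIV - {0::int}. (1 - exp (- of_real (4 * pi\<^sup>2 * (of_int k)\<^sup>2) * w)) / of_real (4 * pi\<^sup>2 * (of_int k)\<^sup>2))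
     (finite_subsets_at_top (UNIV - {0::int}))"
    by (rule Weierstrass_m_test_general[OF _ summable_on_inverse_square_int]) (use norm_phi_ext_term_le in blast)
  moreover have "continuous_on {w. Re w \<ge> 0} (\<lambda>w. \<Sum>k\<in>X. (1 - exp (- of_real (4 * pi\<^sup>2 * (of_int k)\<^sup>2) * w)) / of_real (4 * pi\<^sup>2 * (of_int k)\<^sup>2))" 
    if X: "X \<subseteq> UNIV - {0::int}" for X
    using X by (intro continuous_intros) auto
  ultimately have "continuous_on {w. Re w \<ge> 0} (\<lambda>w. \<Sum>\<^sub>\<infinity>k\<in>UNIV - {0::int}. (1 - exp (- of_real (4 * pi\<^sup>2 * (of_int k)\<^sup>2) * w)) / of_real (4 * pi\<^sup>2 * (of_int k)\<^sup>2))"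
    by (intro uniform_limit_theorem) (auto intro!: eventually_finite_subsets_at_top_weakI)
  then show ?thesis unfolding phi_ext_def by (intro continuous_intros)
qed

lemma continuous_on_phi: "continuous_on UNIV phi"
proof -
  have "continuous_on UNIV (\<lambda>t. phi_ext (\<i> * of_real t))"
    by (rule continuous_on_compose2[OF continuous_on_phi_ext]) (auto intro!: continuous_intros)
  then show ?thesis by (simp add: phi_eq_phi_ext[abs_def])
qed

text \<open>Jacobi's theta constant, the sum of x^(k^2) over all integers k, with nome x = exp (- 4
  pi^2 w).\<close>

definition theta_series :: "complex \<Rightarrow> complex" where
  "theta_series w = (\<Sum>\<^sub>\<infinity>k::int. exp (- of_real (4 * pi\<^sup>2 * (of_int k)\<^sup>2) * w))"

lemma DERIV_phi_ext:
  assumes w: "Re w > 0"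
  shows "(phi_ext has_field_derivative theta_series w) (at w)"
proof -
  define u where "u k w = (1 - exp (- of_real (4 * pi\<^sup>2 * (of_int k)\<^sup>2) * w)) / of_real (4 * pi\<^sup>2 * (of_int k)\<^sup>2)" for k :: int and w :: complex
  have op: "open {w. Re w > 0}" by (rule open_halfspace_Re_gt)
  have d: "(u k has_field_derivative exp (- of_real (4 * pi\<^sup>2 * (of_int k)\<^sup>2) * w)) (at w)" if "k \<in> UNIV - {0}" for k w
    unfolding u_def using that by (auto intro!: derivative_eq_intros)
  have b: "norm (u k w) \<le> 1 / (of_int k)\<^sup>2" if "w \<in> {w. Re w > 0}" for k w
    unfolding u_def using that by (intro norm_phi_ext_term_le) auto
  note D = has_field_derivative_infsum[where I = "UNIV - {0}", OF op _ d b summable_on_inverse_square_int, simplified mem_Collect_eq, OF w]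
  have "theta_series w = (\<Sum>\<^sub>\<infinity>k\<in>insert 0 (UNIV - {0::int}). exp (- of_real (4 * pi\<^sup>2 * (of_int k)\<^sup>2) * w))"
    unfolding theta_series_def by (rule infsum_cong_neutral) auto
  also have "\<dots> = 1 + (\<Sum>\<^sub>\<infinity>k\<in>UNIV - {0::int}. exp (- of_real (4 * pi\<^sup>2 * (of_int k)\<^sup>2) * w))"
    using D(2) by (subst infsum_insert) auto
  finally have t: "theta_series w = 1 + (\<Sum>\<^sub>\<infinity>k\<in>UNIV - {0::int}. exp (- of_real (4 * pi\<^sup>2 * (of_int k)\<^sup>2) * w))" .
  have "((\<lambda>w. w + (\<Sum>\<^sub>\<infinity>k\<in>UNIV - {0::int}. u k w)) has_field_derivative theta_series w) (at w)"
    unfolding t using D(1) by (intro DERIV_add DERIV_ident) simp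
  then show ?thesis by (simp add: phi_ext_def[abs_def] u_def)
qed

text \<open>These are the nonzero frequencies produced by Poisson summation near
  \<open>p / (2 * pi * q)\<close>. Frequency 0 is left out because it gives the main term, while the
  others decay as w tends to 0 along the positive reals and oscillate near the imaginary
  axis.\<close>

definition dual_series :: "int \<Rightarrow> nat \<Rightarrow> complex \<Rightarrow> complex" where
  "dual_series p q w = (\<Sum>\<^sub>\<infinity>m\<in>UNIV - {0::int}. quadratic_gauss_sum p q m * exp (- of_real ((of_int m)\<^sup>2 / (4 * (real q)\<^sup>2)) / w))"

text \<open>Termwise antiderivative of \<open>dual_series p q w / w\<^sup>2\<close>. Unlike \<open>dual_series\<close>, it is bounded up to the imaginary axis,
  so one integration by parts controls the oscillating part of \<open>phi_ext\<close>.\<close>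
definition dual_primitive :: "int \<Rightarrow> nat \<Rightarrow> complex \<Rightarrow> complex" where
  "dual_primitive p q w = (\<Sum>\<^sub>\<infinity>m\<in>UNIV - {0::int}. of_real (4 * (real q)\<^sup>2 / (of_int m)\<^sup>2) * quadratic_gauss_sum p q m
      * exp (- of_real ((of_int m)\<^sup>2 / (4 * (real q)\<^sup>2)) / w))"

definition inverse_square_sum :: real where
  "inverse_square_sum = (\<Sum>\<^sub>\<infinity>m\<in>UNIV - {0::int}. 1 / (of_int m)\<^sup>2)"

lemma inverse_square_sum_nonneg: "inverse_square_sum \<ge> 0"
  unfolding inverse_square_sum_def by (intro infsum_nonneg) auto

context
  fixes p :: int and q :: nat
  assumes q: "q > 0" and cop: "coprime p (int q)"
begin

lemma norm_dual_primitive_term_le: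
  fixes m :: int
  assumes "Re w > 0"
  shows "norm (of_real (4 * (real q)\<^sup>2 / (of_int m)\<^sup>2) * quadratic_gauss_sum p q m
      * exp (- of_real ((of_int m)\<^sup>2 / (4 * (real q)\<^sup>2)) / w)) \<le> sqrt (2 * real q) * (4 * (real q)\<^sup>2) * (1 / (of_int m)\<^sup>2)"
proof -
  have "Re (of_real x / w) \<ge> 0" if "x \<ge> 0" for x
    using that assms by (simp add: Re_divide)
  then have "norm (exp (- of_real ((of_int m)\<^sup>2 / (4 * (real q)\<^sup>2)) / w)) \<le> 1"
    by (simp del: of_real_divide)
  then have "norm (of_real (4 * (real q)\<^sup>2 / (of_int m)\<^sup>2) * quadratic_gauss_sum p q m
      * exp (- of_real ((of_int m)\<^sup>2 / (4 * (real q)\<^sup>2)) / w)) \<le> (4 * (real q)\<^sup>2 / (of_int m)\<^sup>2) * sqrt (2 * real q) * 1"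
    unfolding norm_mult using norm_quadratic_gauss_sum_le[OF q cop, of m]
    by (intro mult_mono) (auto simp del: of_real_divide simp: norm_of_real)
  then show ?thesis by (simp add: mult_ac)
qed

text \<open>The inverse squares in \<open>dual_primitive\<close> give a majorant on the whole
  half-plane. Summability of the dual series is then inherited from termwise differentiation, after
  multiplying by \<open>w\<^sup>2\<close>.\<close>

lemma DERIV_dual_primitive:
  assumes w: "Re w > 0"
  shows "(dual_primitive p q has_field_derivative dual_series p q w / w\<^sup>2) (at w)"
    and "(\<lambda>m. quadratic_gauss_sum p q m * exp (- of_real ((of_int m)\<^sup>2 / (4 * (real q)\<^sup>2)) / w)) summable_on (UNIV - {0})"
proof -
  have op: "open {w. Re w > 0}" by (rule open_halfspace_Re_gt)
  have d: "((\<lambda>w. of_real (4 * (real q)\<^sup>2 / (of_int m)\<^sup>2) * quadratic_gauss_sum p q m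
      * exp (- of_real ((of_int m)\<^sup>2 / (4 * (real q)\<^sup>2)) / w)) has_field_derivative
      (quadratic_gauss_sum p q m * exp (- of_real ((of_int m)\<^sup>2 / (4 * (real q)\<^sup>2)) / w)) * (1 / w\<^sup>2)) (at w)"
    if "m \<in> UNIV - {0}" "w \<in> {w. Re w > 0}" for m w
  proof -
    have w0: "w \<noteq> 0" using that by auto
    define b :: complex where "b = of_real ((of_int m)\<^sup>2 / (4 * (real q)\<^sup>2))"
    have b: "b \<noteq> 0" and eq: "of_real (4 * (real q)\<^sup>2 / (of_int m)\<^sup>2) = 1 / b" using that q by (auto simp: b_def)
    have "((\<lambda>w. 1 / b * quadratic_gauss_sum p q m * exp (- b / w)) has_field_derivative
      (quadratic_gauss_sum p q m * exp (- b / w)) * (1 / w\<^sup>2)) (at w)"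
      using w0 b by (auto intro!: derivative_eq_intros simp: power2_eq_square)
    then show ?thesis unfolding eq unfolding b_def .
  qed
  define u where "u m w = of_real (4 * (real q)\<^sup>2 / (of_int m)\<^sup>2) * quadratic_gauss_sum p q m
      * exp (- of_real ((of_int m)\<^sup>2 / (4 * (real q)\<^sup>2)) / w)" for m :: int and w
  define u' where "u' m w = quadratic_gauss_sum p q m * exp (- of_real ((of_int m)\<^sup>2 / (4 * (real q)\<^sup>2)) / w)" for m :: int and w
  define M where "M m = sqrt (2 * real q) * (4 * (real q)\<^sup>2) * (1 / (of_int m)\<^sup>2)" for m :: int
  have du: "(u m has_field_derivative u' m w * (1 / w\<^sup>2)) (at w)" if "m \<in> UNIV - {0}" "w \<in> {w. Re w > 0}" for m w
    unfolding u_def u'_def using d[OF that] .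
  have uM: "norm (u m w) \<le> M m" if "w \<in> {w. Re w > 0}" for m w
    unfolding u_def M_def using that by (intro norm_dual_primitive_term_le) simp
  have M: "M summable_on (UNIV - {0})"
    unfolding M_def by (intro summable_on_cmult_right summable_on_inverse_square_int)
  have wS: "w \<in> {w. Re w > 0}" using w by simp
  note D = has_field_derivative_infsum[where f = u and I = "UNIV - {0}" and f' = "\<lambda>m w. u' m w * (1 / w\<^sup>2)", OF op wS du uM M]
  have w0: "w \<noteq> 0" using w by auto
  have "(\<lambda>m. u' m w) summable_on (UNIV - {0})"
    by (rule summable_on_cong[THEN iffD1, OF _ summable_on_cmult_left[OF D(2), of "w\<^sup>2"]]) (use w0 in simp)
  then show "(\<lambda>m. quadratic_gauss_sum p q m * exp (- of_real ((of_int m)\<^sup>2 / (4 * (real q)\<^sup>2)) / w)) summable_on (UNIV - {0})"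
    by (simp only: u'_def)
  have "(\<Sum>\<^sub>\<infinity>m\<in>UNIV - {0}. u' m w * (1 / w\<^sup>2)) = dual_series p q w / w\<^sup>2"
    unfolding dual_series_def u'_def[symmetric] by (subst infsum_cmult_left') simp
  moreover have "dual_primitive p q = (\<lambda>w. \<Sum>\<^sub>\<infinity>m\<in>UNIV - {0}. u m w)"
    by (simp only: dual_primitive_def[abs_def] u_def)
  ultimately show "(dual_primitive p q has_field_derivative dual_series p q w / w\<^sup>2) (at w)"
    using D(1) by (simp only:)
qed

lemma norm_dual_primitive_le:
  assumes "Re w > 0"
  shows "norm (dual_primitive p q w) \<le> sqrt (2 * real q) * (4 * (real q)\<^sup>2) * inverse_square_sum"
proof -
  have "norm (dual_primitive p q w) \<le> (\<Sum>\<^sub>\<infinity>m\<in>UNIV - {0::int}. sqrt (2 * real q) * (4 * (real q)\<^sup>2) * (1 / (of_int m)\<^sup>2))"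
    unfolding dual_primitive_def
    by (rule norm_infsum_le[OF has_sum_infsum has_sum_infsum])
       (intro norm_dual_primitive_term_le assms summable_on_cmult_right summable_on_inverse_square_int
          summable_on_norm_bound[OF _ norm_dual_primitive_term_le[OF assms]])+
  also have "\<dots> = sqrt (2 * real q) * (4 * (real q)\<^sup>2) * inverse_square_sum"
    unfolding inverse_square_sum_def by (rule infsum_cmult_right')
  finally show ?thesis .
qed

end

section \<open>Transformation law of the theta series at rational points\<close>

lemma has_sum_finite_sum:
  fixes f :: "'i \<Rightarrow> 'a \<Rightarrow> 'b :: topological_comm_monoid_add"
  assumes "finite I" and "\<And>i. i \<in> I \<Longrightarrow> (f i has_sum s i) A"
  shows "((\<lambda>x. \<Sum>i\<in>I. f i x) has_sum (\<Sum>i\<in>I. s i)) A"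
  using assms by (induction rule: finite_induct) (auto intro!: has_sum_add)

lemma norm_csqrt_eq: "norm (csqrt z) = sqrt (norm z)"
  by (metis norm_ge_zero norm_power power2_csqrt real_sqrt_unique)

text \<open>At a rational point the oscillating factor of the k-th term depends only on k mod q. The
  theta series thus splits into q sums of Gaussians shifted by \<open>r / q\<close>, with width
  parameter \<open>\<tau> = 4 * pi * q\<^sup>2 * y\<close>. Poisson summation in each class turns
  the shifts into phases, which combine with the oscillating factors to the Gauss sums.\<close>

lemma theta_series_rational_of_real:
  fixes y :: real
  assumes q: "q > 0" and cop: "coprime p (int q)" and y: "y > 0"
  shows "theta_series (\<i> * of_real (of_int p / (2 * pi * real q)) + of_real y)
     = (quadratic_gauss_sum p q 0 + dual_series p q (of_real y)) / (of_real (2 * real q * sqrt pi) * csqrt (of_real y))"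
proof -
  define \<tau> where "\<tau> = 4 * pi * (real q)\<^sup>2 * y"
  have \<tau>: "\<tau> > 0" using q y by (simp add: \<tau>_def)
  have sq: "sqrt \<tau> = 2 * real q * sqrt pi * sqrt y"
    by (simp add: \<tau>_def real_sqrt_mult)
  define A where "A r = (\<Sum>\<^sub>\<infinity>j::int. complex_of_real (exp (- pi * \<tau> * (of_int j + of_int r / real q)\<^sup>2)))" for r :: int
  define E where "E r = cis (- 2 * pi * of_int (p * r\<^sup>2) / real q)" for r :: int
  have "((\<lambda>m::int. \<Sum>r\<in>{0..<int q}. E r * (cis (2 * pi * of_int m * (of_int r / real q)) * of_real (exp (- pi * (of_int m)\<^sup>2 / \<tau>) / sqrt \<tau>)))
      has_sum (\<Sum>r\<in>{0..<int q}. E r * A r)) UNIV"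
    unfolding A_def by (intro has_sum_finite_sum has_sum_cmult_right Poisson_summation_gaussian \<tau>) auto
  moreover have "(\<Sum>r\<in>{0..<int q}. E r * (cis (2 * pi * of_int m * (of_int r / real q)) * of_real (exp (- pi * (of_int m)\<^sup>2 / \<tau>) / sqrt \<tau>)))
     = quadratic_gauss_sum p q m * exp (- of_real ((of_int m)\<^sup>2 / (4 * (real q)\<^sup>2)) / of_real y) * (1 / of_real (sqrt \<tau>))" for m
  proof -
    have "E r * cis (2 * pi * of_int m * (of_int r / real q)) = cis (2 * pi * of_int (m * r - p * r\<^sup>2) / real q)" for r
      unfolding E_def cis_mult by (rule arg_cong[of _ _ cis]) (use q in \<open>simp add: field_simps\<close>)
    then have e1: "E r * (cis (2 * pi * of_int m * (of_int r / real q)) * of_real x) = cis (2 * pi * of_int (m * r - p * r\<^sup>2) / real q) * of_real x" for r x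
      by (simp only: mult.assoc[symmetric])
    have "- pi * (of_int m)\<^sup>2 / \<tau> = - ((of_int m)\<^sup>2 / (4 * (real q)\<^sup>2)) / y"
      using q y by (simp add: \<tau>_def)
    then have e2: "complex_of_real (exp (- pi * (of_int m)\<^sup>2 / \<tau>)) = exp (- of_real ((of_int m)\<^sup>2 / (4 * (real q)\<^sup>2)) / of_real y)"
      by (simp only: exp_of_real[symmetric] of_real_divide[symmetric] of_real_minus[symmetric])
    have "(\<Sum>r\<in>{0..<int q}. E r * (cis (2 * pi * of_int m * (of_int r / real q)) * of_real (exp (- pi * (of_int m)\<^sup>2 / \<tau>) / sqrt \<tau>)))
       = quadratic_gauss_sum p q m * of_real (exp (- pi * (of_int m)\<^sup>2 / \<tau>) / sqrt \<tau>)"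
      unfolding quadratic_gauss_sum_def sum_distrib_right by (simp only: e1)
    also have "\<dots> = quadratic_gauss_sum p q m * (of_real (exp (- pi * (of_int m)\<^sup>2 / \<tau>)) * (1 / of_real (sqrt \<tau>)))"
      by simp
    finally show ?thesis unfolding e2 by (simp only: mult.assoc)
  qed
  ultimately have dual: "((\<lambda>m::int. quadratic_gauss_sum p q m * exp (- of_real ((of_int m)\<^sup>2 / (4 * (real q)\<^sup>2)) / of_real y) * (1 / of_real (sqrt \<tau>)))
      has_sum (\<Sum>r\<in>{0..<int q}. E r * A r)) UNIV" by simp
  have "(\<Sum>\<^sub>\<infinity>m\<in>insert 0 (UNIV - {0::int}). quadratic_gauss_sum p q m * exp (- of_real ((of_int m)\<^sup>2 / (4 * (real q)\<^sup>2)) / of_real y))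
     = quadratic_gauss_sum p q 0 + dual_series p q (of_real y)"
    unfolding dual_series_def using DERIV_dual_primitive(2)[OF q cop, of "of_real y"] y by (subst infsum_insert) auto
  moreover have "insert 0 (UNIV - {0::int}) = UNIV" by auto
  ultimately have dual': "(\<Sum>r\<in>{0..<int q}. E r * A r) = (quadratic_gauss_sum p q 0 + dual_series p q (of_real y)) * (1 / of_real (sqrt \<tau>))"
    using infsumI[OF dual] by (simp only: infsum_cmult_left')
  have "((\<lambda>k::int. exp (- of_real (4 * pi\<^sup>2 * (of_int k)\<^sup>2) * (\<i> * of_real (of_int p / (2 * pi * real q)) + of_real y)))
      has_sum (\<Sum>r\<in>{0..<int q}. E r * A r)) (\<Union>r\<in>{0..<int q}. {k. k mod int q = r})"
  proof (rule sum_has_sum)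
    fix r assume r: "r \<in> {0..<int q}"
    have "(\<lambda>j::int. complex_of_real (exp (- pi * \<tau> * (of_int j + of_int r / real q)\<^sup>2))) summable_on UNIV"
    proof (rule summable_on_norm_bound)
      show "(\<lambda>j::int. exp (pi * \<tau> * (norm (complex_of_real (of_int r / real q)))\<^sup>2) * exp (- (pi * \<tau> / 2) * (of_int j)\<^sup>2)) summable_on UNIV"
        using \<tau> by (intro summable_on_cmult_right summable_on_exp_square_int) auto
      fix j :: int
      have "complex_of_real (exp (- pi * \<tau> * (of_int j + of_int r / real q)\<^sup>2)) = exp (- of_real (pi * \<tau>) * (of_int j + of_real (of_int r / real q))\<^sup>2)"
        by (simp add: exp_of_real[symmetric])
      then show "norm (complex_of_real (exp (- pi * \<tau> * (of_int j + of_int r / real q)\<^sup>2)))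
         \<le> exp (pi * \<tau> * (norm (complex_of_real (of_int r / real q)))\<^sup>2) * exp (- (pi * \<tau> / 2) * (of_int j)\<^sup>2)"
        using norm_gaussian_shift_le[OF \<tau>, of j "of_real (of_int r / real q)"] by simp
    qed
    then have "((\<lambda>j::int. E r * complex_of_real (exp (- pi * \<tau> * (of_int j + of_int r / real q)\<^sup>2))) has_sum E r * A r) UNIV"
      unfolding A_def by (intro has_sum_cmult_right has_sum_infsum)
    also have "?this \<longleftrightarrow> ((\<lambda>k::int. exp (- of_real (4 * pi\<^sup>2 * (of_int k)\<^sup>2) * (\<i> * of_real (of_int p / (2 * pi * real q)) + of_real y))) has_sum E r * A r) {k. k mod int q = r}"
    proof (rule has_sum_reindex_bij_witness[of _ "\<lambda>k. k div int q" "\<lambda>j. j * int q + r"])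
      fix j :: int
      let ?k = "j * int q + r"
      have kr: "[?k = r] (mod int q)" by (simp add: cong_def)
      have "exp (- of_real (4 * pi\<^sup>2 * (of_int ?k)\<^sup>2) * (\<i> * of_real (of_int p / (2 * pi * real q)) + of_real y))
         = exp (\<i> * of_real (- (4 * pi\<^sup>2 * (of_int ?k)\<^sup>2) * (of_int p / (2 * pi * real q)))) * exp (of_real (- (4 * pi\<^sup>2 * (of_int ?k)\<^sup>2) * y))"
        unfolding exp_add[symmetric] by (rule arg_cong[of _ _ exp]) (simp add: algebra_simps)
      also have "exp (\<i> * of_real (- (4 * pi\<^sup>2 * (of_int ?k)\<^sup>2) * (of_int p / (2 * pi * real q)))) = cis (2 * pi * of_int (- p * ?k\<^sup>2) / real q)"
        unfolding cis_conv_exp[symmetric] by (rule arg_cong[of _ _ cis]) (use q in \<open>simp add: field_simps power2_eq_square\<close>)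
      also have "\<dots> = cis (2 * pi * of_int (- p * r\<^sup>2) / real q)"
        by (intro cis_2pi_div_cong q cong_mult cong_refl cong_pow kr)
      also have "\<dots> = E r" by (simp add: E_def)
      also have "- (4 * pi\<^sup>2 * (of_int ?k)\<^sup>2) * y = - pi * \<tau> * (of_int j + of_int r / real q)\<^sup>2"
      proof -
        have "real_of_int ?k = real q * (of_int j + of_int r / real q)" using q by (simp add: field_simps)
        then have "(real_of_int ?k)\<^sup>2 = (real q)\<^sup>2 * (of_int j + of_int r / real q)\<^sup>2" by (simp only: power_mult_distrib)
        then show ?thesis by (simp only: \<tau>_def) (simp add: power2_eq_square)
      qed
      finally show "exp (- of_real (4 * pi\<^sup>2 * (of_int ?k)\<^sup>2) * (\<i> * of_real (of_int p / (2 * pi * real q)) + of_real y))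
         = E r * complex_of_real (exp (- pi * \<tau> * (of_int j + of_int r / real q)\<^sup>2))"
        by (simp only: exp_of_real)
    qed (use q r in auto)
    finally show "((\<lambda>k::int. exp (- of_real (4 * pi\<^sup>2 * (of_int k)\<^sup>2) * (\<i> * of_real (of_int p / (2 * pi * real q)) + of_real y))) has_sum E r * A r) {k. k mod int q = r}" .
  qed auto
  moreover have "(\<Union>r\<in>{0..<int q}. {k. k mod int q = r}) = UNIV" using q by auto
  ultimately have "theta_series (\<i> * of_real (of_int p / (2 * pi * real q)) + of_real y) = (\<Sum>r\<in>{0..<int q}. E r * A r)"
    unfolding theta_series_def by (simp only: infsumI)
  then show ?thesis
    unfolding dual' sq using y by (simp add: csqrt_of_real)
qed

text \<open>The real Gaussians of the Poisson formula give the identity only for positive real w,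
  and the identity theorem extends it to the half-plane. Both series are recognised as holomorphic
  through their primitives \<open>phi_ext\<close> and \<open>dual_primitive\<close>.\<close>

lemma theta_series_rational:
  assumes q: "q > 0" and cop: "coprime p (int q)" and w: "Re w > 0"
  shows "theta_series (\<i> * of_real (of_int p / (2 * pi * real q)) + w)
     = (quadratic_gauss_sum p q 0 + dual_series p q w) / (of_real (2 * real q * sqrt pi) * csqrt w)"
proof -
  define T where "T = \<i> * complex_of_real (of_int p / (2 * pi * real q))"
  define S where "S = {w. Re w > 0}"
  have opS: "open S" unfolding S_def by (rule open_halfspace_Re_gt)
  have ReT: "Re (T + w) = Re w" for w by (simp add: T_def)
  have "(\<lambda>w. deriv phi_ext (T + w)) holomorphic_on S"
  proof -
    have "phi_ext holomorphic_on S"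
      unfolding holomorphic_on_open[OF opS] using DERIV_phi_ext by (auto simp: S_def)
    then have "deriv phi_ext holomorphic_on S" using opS by (rule holomorphic_deriv)
    moreover have "(\<lambda>w. T + w) holomorphic_on S" by (intro holomorphic_intros)
    moreover have "(\<lambda>w. T + w) ` S \<subseteq> S" by (auto simp: S_def T_def)
    ultimately have "(deriv phi_ext \<circ> (\<lambda>w. T + w)) holomorphic_on S"
      using holomorphic_on_compose_gen by blast
    then show ?thesis by (simp add: o_def)
  qed
  then have hol1: "(\<lambda>w. theta_series (T + w)) holomorphic_on S"
    by (rule holomorphic_transform) (use DERIV_phi_ext ReT in \<open>auto simp: S_def intro: DERIV_imp_deriv\<close>)
  have "dual_primitive p q holomorphic_on S"
    unfolding holomorphic_on_open[OF opS] using DERIV_dual_primitive(1)[OF q cop] by (auto simp: S_def)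
  then have "(\<lambda>w. w\<^sup>2 * deriv (dual_primitive p q) w) holomorphic_on S"
    by (intro holomorphic_intros holomorphic_deriv opS)
  then have hol2: "dual_series p q holomorphic_on S"
    by (rule holomorphic_transform) (use DERIV_imp_deriv[OF DERIV_dual_primitive(1)[OF q cop]] in \<open>auto simp: S_def\<close>)
  have S_nonneg: "w \<notin> \<real>\<^sub>\<le>\<^sub>0" if "w \<in> S" for w using that by (auto simp: S_def complex_nonpos_Reals_iff)
  have q0: "of_real (2 * real q * sqrt pi) \<noteq> (0::complex)" using q by simp
  have csq0: "csqrt w \<noteq> 0" if "w \<in> S" for w using that by (auto simp: S_def)
  have "(\<lambda>w. theta_series (T + w) - (quadratic_gauss_sum p q 0 + dual_series p q w) / (of_real (2 * real q * sqrt pi) * csqrt w)) holomorphic_on S"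
    using S_nonneg csq0 q by (intro holomorphic_intros hol1 hol2) auto
  then have "theta_series (T + w) - (quadratic_gauss_sum p q 0 + dual_series p q w) / (of_real (2 * real q * sqrt pi) * csqrt w) = 0"
  proof (rule analytic_continuation[where U = "of_real ` {0<..}" and \<xi> = 1])
    show "connected S" unfolding S_def by (intro convex_connected convex_halfspace_Re_gt)
    show "(1::complex) islimpt of_real ` {0<..}"
    proof -
      have "(1::real) islimpt {0<..}" by (rule interior_limit_point) (simp add: interior_open)
      then have "of_real (1::real) islimpt (of_real ` {0<..} :: complex set)"
        unfolding islimpt_approachable
        by (metis (no_types, opaque_lifting) dist_of_real image_eqI of_real_eq_iff)
      then show ?thesis by simp
    qed
    fix z :: complex assume "z \<in> of_real ` {0<..}"
    then show "theta_series (T + z) - (quadratic_gauss_sum p q 0 + dual_series p q z) / (of_real (2 * real q * sqrt pi) * csqrt z) = 0"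
      using theta_series_rational_of_real[OF q cop] by (auto simp: T_def simp del: of_real_mult of_real_divide)
  qed (use opS w in \<open>auto simp: S_def\<close>)
  then show ?thesis by (simp add: T_def)
qed

text \<open>This is the transformation law integrated from 0 to w: the Gauss sum at frequency 0
  integrates to the multiple of \<open>csqrt w\<close>, the dual series to the error. The bound
  depends on w only through its norm, so it is still available in the limit at the imaginary
  axis.\<close>

lemma phi_ext_asymp:
  assumes q: "q > 0" and cop: "coprime p (int q)" and w: "Re w > 0"
  defines "T \<equiv> \<i> * complex_of_real (of_int p / (2 * pi * real q))"
  shows "norm (phi_ext (T + w) - phi_ext T - quadratic_gauss_sum p q 0 / of_real (real q * sqrt pi) * csqrt w)
     \<le> 5 * inverse_square_sum * (real q * sqrt (real q)) * (norm w * sqrt (norm w))"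
proof -
  have ReT: "Re (T + w) = Re w" for w by (simp add: T_def)
  define Z where "Z = inverse_square_sum"
  have Z: "Z \<ge> 0" unfolding Z_def by (rule inverse_square_sum_nonneg)
  define b where "b = complex_of_real (2 * real q * sqrt pi)"
  have b0: "b \<noteq> 0" using q by (simp add: b_def)
  have nb: "norm b = 2 * real q * sqrt pi" by (simp add: b_def norm_mult)
  define G where "G = quadratic_gauss_sum p q 0"
  define D where "D = dual_primitive p q"
  define C where "C = sqrt (2 * real q) * (4 * (real q)\<^sup>2) * Z"
  have C: "C \<ge> 0" using Z by (simp add: C_def)
  have DC: "norm (D z) \<le> C" if "Re z > 0" for z
    unfolding D_def C_def Z_def using norm_dual_primitive_le[OF q cop that] .
  \<comment> \<open>The last term is the boundary term of the integration by parts; after removing it the derivative is \<open>O(sqrt (norm z))\<close>.\<close>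
  define \<Psi> where "\<Psi> z = phi_ext (T + z) - phi_ext T - 2 * G / b * csqrt z - z * csqrt z * D z / b" for z
  have dPsi: "(\<Psi> has_field_derivative - (3 / 2) * csqrt z * D z / b) (at z)" if z: "Re z > 0" for z
  proof -
    have zn: "z \<notin> \<real>\<^sub>\<le>\<^sub>0" and z0: "z \<noteq> 0" using z by (auto simp: complex_nonpos_Reals_iff)
    have dphi: "((\<lambda>z. phi_ext (T + z)) has_field_derivative (G + dual_series p q z) / (b * csqrt z)) (at z)"
    proof -
      have "(phi_ext has_field_derivative theta_series (T + z)) (at (z + T))"
        using DERIV_phi_ext[of "T + z"] z ReT by (simp add: add.commute)
      then have "((\<lambda>z. phi_ext (z + T)) has_field_derivative theta_series (T + z)) (at z)"
        by (rule DERIV_shift[THEN iffD1])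
      then show ?thesis using theta_series_rational[OF q cop z] by (simp add: T_def G_def b_def add.commute)
    qed
    have dD: "(D has_field_derivative dual_series p q z / z\<^sup>2) (at z)"
      unfolding D_def by (rule DERIV_dual_primitive(1)[OF q cop z])
    \<comment> \<open>Writing z as \<open>c\<^sup>2\<close> turns the derivative into a rational
      expression in which the Gauss sum and the dual series cancel and only the multiple of
      \<open>D z\<close> coming from the product rule survives.\<close>
    define c where "c = csqrt z"
    have c: "c \<noteq> 0" "z = c\<^sup>2" using z0 by (auto simp: c_def)
    have "(\<Psi> has_field_derivative ((G + dual_series p q z) / (b * csqrt z) - 0 - 2 * G / b * inverse (2 * csqrt z)
       - ((1 * csqrt z + inverse (2 * csqrt z) * z) * D z + dual_series p q z / z\<^sup>2 * (z * csqrt z)) / b)) (at z)"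
      unfolding \<Psi>_def
      by (intro DERIV_diff DERIV_cdivide DERIV_mult DERIV_ident DERIV_const dphi dD DERIV_cmult has_field_derivative_csqrt zn)
    moreover have "(G + A) / (b * c) - 0 - 2 * G / b * inverse (2 * c)
       - ((1 * c + inverse (2 * c) * c\<^sup>2) * B + A / (c\<^sup>2)\<^sup>2 * (c\<^sup>2 * c)) / b = - (3 / 2) * c * B / b" for A B
      using c(1) b0 by (simp add: field_simps power2_eq_square)
    then have "((G + dual_series p q z) / (b * csqrt z) - 0 - 2 * G / b * inverse (2 * csqrt z)
       - ((1 * csqrt z + inverse (2 * csqrt z) * z) * D z + dual_series p q z / z\<^sup>2 * (z * csqrt z)) / b) = - (3 / 2) * csqrt z * D z / b"
      by (simp only: c_def[symmetric] c(2)[symmetric])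
    ultimately show ?thesis by (simp only:)
  qed
  define R where "R = norm w"
  have R: "R > 0" using w by (auto simp: R_def)
  \<comment> \<open>The mean value estimate is applied on a segment that stops short of 0, because 0
    lies on the boundary of the half-plane; \<open>lim0\<close> then lets e tend to 0.\<close>
  have bound: "norm (\<Psi> w - \<Psi> (of_real e * w)) \<le> (3 / 2) * sqrt R * C / norm b * R" if e: "0 < e" "e < 1" for e
  proof -
    have seg: "Re z > 0 \<and> norm z \<le> R" if zs: "z \<in> closed_segment (of_real e * w) w" for z
    proof -
      obtain u where u: "0 \<le> u" "u \<le> 1" "z = (1 - u) *\<^sub>R (of_real e * w) + u *\<^sub>R w"
        using zs by (auto simp: in_segment)
      define l where "l = (1 - u) * e + u"
      have z: "z = of_real l * w" unfolding u(3) l_def by (simp add: scaleR_conv_of_real algebra_simps)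
      have l: "0 < l" "l \<le> 1"
      proof -
        show "0 < l" unfolding l_def using u e by (cases "u = 0") (auto intro: add_nonneg_pos)
        have "(1 - u) * e \<le> (1 - u) * 1" using u e by (intro mult_left_mono) auto
        then show "l \<le> 1" by (simp add: l_def)
      qed
      then show ?thesis unfolding z using w by (auto simp: norm_mult R_def intro: mult_left_le_one_le)
    qed
    have "norm (\<Psi> w - \<Psi> (of_real e * w)) \<le> ((3 / 2) * sqrt R * C / norm b) * norm (w - of_real e * w)"
    proof (rule field_differentiable_bound[where S = "closed_segment (of_real e * w) w"])
      fix z assume z: "z \<in> closed_segment (of_real e * w) w"
      show "(\<Psi> has_field_derivative - (3 / 2) * csqrt z * D z / b) (at z within closed_segment (of_real e * w) w)"
        using dPsi seg[OF z] by (auto intro: has_field_derivative_at_within)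
      have "norm (- (3 / 2) * csqrt z * D z / b) = (3 / 2) * sqrt (norm z) * norm (D z) / norm b"
        by (simp add: norm_mult norm_divide norm_csqrt_eq)
      also have "\<dots> \<le> (3 / 2) * sqrt R * C / norm b"
        using seg[OF z] DC R by (intro divide_right_mono mult_mono) auto
      finally show "norm (- (3 / 2) * csqrt z * D z / b) \<le> (3 / 2) * sqrt R * C / norm b" .
    qed auto
    also have "norm (w - of_real e * w) = (1 - e) * R"
    proof -
      have "w - of_real e * w = of_real (1 - e) * w" by (simp add: algebra_simps)
      then show ?thesis using e by (simp add: norm_mult R_def del: of_real_diff)
    qed
    also have "((3 / 2) * sqrt R * C / norm b) * ((1 - e) * R) \<le> ((3 / 2) * sqrt R * C / norm b) * R"
      using e R C by (intro mult_left_mono) (auto intro!: mult_nonneg_nonneg divide_nonneg_nonneg)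
    finally show ?thesis .
  qed
  have lim0: "((\<lambda>e. \<Psi> (of_real e * w)) \<longlongrightarrow> 0) (at_right 0)"
  proof -
    have cs: "((\<lambda>e. csqrt (of_real e * w)) \<longlongrightarrow> 0) (at_right 0)"
    proof (rule tendsto_norm_zero_cancel)
      have "((\<lambda>e. sqrt (\<bar>e\<bar> * norm w)) \<longlongrightarrow> sqrt (\<bar>0\<bar> * norm w)) (at_right 0)"
        by (intro tendsto_intros)
      then show "((\<lambda>e. norm (csqrt (of_real e * w))) \<longlongrightarrow> 0) (at_right 0)"
        by (simp add: norm_csqrt_eq norm_mult)
    qed
    have ew: "((\<lambda>e. of_real e * w) \<longlongrightarrow> of_real 0 * w) (at_right 0)" by (intro tendsto_intros)
    have "((\<lambda>e. phi_ext (T + of_real e * w)) \<longlongrightarrow> phi_ext T) (at_right 0)"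
    proof (rule continuous_on_tendsto_compose[OF continuous_on_phi_ext])
      show "((\<lambda>e. T + of_real e * w) \<longlongrightarrow> T) (at_right 0)" using tendsto_add[OF tendsto_const ew, of T] by simp
      show "T \<in> {w. 0 \<le> Re w}" by (simp add: T_def)
      show "\<forall>\<^sub>F e in at_right 0. T + of_real e * w \<in> {w. 0 \<le> Re w}"
        using eventually_at_right_less[of 0] by eventually_elim (use w in \<open>auto simp: T_def\<close>)
    qed
    then have l1: "((\<lambda>e. phi_ext (T + of_real e * w) - phi_ext T - 2 * G / b * csqrt (of_real e * w)) \<longlongrightarrow> phi_ext T - phi_ext T - 2 * G / b * 0) (at_right 0)"
      by (intro tendsto_intros cs)
    have l2: "((\<lambda>e. (of_real e * w) * csqrt (of_real e * w) * D (of_real e * w) / b) \<longlongrightarrow> 0) (at_right 0)"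
    proof (rule Lim_null_comparison)
      show "\<forall>\<^sub>F e in at_right 0. norm ((of_real e * w) * csqrt (of_real e * w) * D (of_real e * w) / b)
          \<le> norm ((of_real e * w) * csqrt (of_real e * w)) * C / norm b"
        using eventually_at_right_less[of 0]
      proof eventually_elim
        case (elim e)
        then have "norm (D (of_real e * w)) \<le> C" using w by (intro DC) simp
        then show ?case unfolding norm_divide norm_mult by (intro divide_right_mono mult_left_mono) auto
      qed
      have "((\<lambda>e. norm ((of_real e * w) * csqrt (of_real e * w)) * C / norm b) \<longlongrightarrow> norm ((of_real 0 * w) * 0) * C / norm b) (at_right 0)"
        by (intro tendsto_intros cs ew) (use b0 in auto)
      then show "((\<lambda>e. norm ((of_real e * w) * csqrt (of_real e * w)) * C / norm b) \<longlongrightarrow> 0) (at_right 0)" by simp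
    qed
    from tendsto_diff[OF l1 l2] show ?thesis by (simp add: \<Psi>_def)
  qed
  have "norm (\<Psi> w - 0) \<le> (3 / 2) * sqrt R * C / norm b * R"
  proof (rule tendsto_upperbound)
    show "((\<lambda>e. norm (\<Psi> w - \<Psi> (of_real e * w))) \<longlongrightarrow> norm (\<Psi> w - 0)) (at_right 0)"
      by (intro tendsto_intros lim0)
    show "\<forall>\<^sub>F e in at_right 0. norm (\<Psi> w - \<Psi> (of_real e * w)) \<le> (3 / 2) * sqrt R * C / norm b * R"
      unfolding eventually_at_right_field using bound by (intro exI[of _ 1]) auto
  qed simp
  moreover have "norm (w * csqrt w * D w / b) \<le> R * sqrt R * C / norm b"
    unfolding norm_divide norm_mult norm_csqrt_eq R_def[symmetric]
    using DC[OF w] R by (intro divide_right_mono mult_left_mono) auto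
  \<comment> \<open>The factor 5/2 is 3/2 from the mean value estimate plus 1 from the boundary
    term. The estimate of \<open>C / norm b\<close>, which uses 2 \<le> pi, doubles it to 5.\<close>
  ultimately have "norm (\<Psi> w + w * csqrt w * D w / b) \<le> (5 / 2) * (C / norm b) * (R * sqrt R)"
    by (intro order_trans[OF norm_triangle_ineq]) (simp add: field_simps)
  also have "C / norm b \<le> 2 * Z * (real q * sqrt (real q))"
  proof -
    have "C = 4 * (real q)\<^sup>2 * sqrt (real q) * Z * sqrt 2" by (simp add: C_def real_sqrt_mult)
    also have "\<dots> \<le> 4 * (real q)\<^sup>2 * sqrt (real q) * Z * sqrt pi"
      using Z pi_ge_two by (intro mult_left_mono) auto
    also have "\<dots> = 2 * Z * (real q * sqrt (real q)) * norm b"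
      by (simp add: nb power2_eq_square)
    finally show ?thesis using b0 by (simp add: divide_le_eq)
  qed
  finally have "norm (\<Psi> w + w * csqrt w * D w / b) \<le> 5 * Z * (real q * sqrt (real q)) * (R * sqrt R)"
    using R by (simp add: mult_right_mono mult_left_mono)
  moreover have "2 * G / b = quadratic_gauss_sum p q 0 / of_real (real q * sqrt pi)"
    using q by (simp add: G_def b_def)
  ultimately show ?thesis by (simp add: \<Psi>_def R_def Z_def)
qed

text \<open>This is the limit of \<open>phi_ext_asymp\<close> at \<open>w = e + \<i> * s\<close> as
  e decreases to 0. For nonzero s the point \<open>\<i> * s\<close> avoids the branch cut of
  \<open>csqrt\<close>, so every term is continuous there.\<close>

theorem phi_asymp_rational:
  assumes q: "q > 0" and cop: "coprime p (int q)"
  defines "T \<equiv> of_int p / (2 * pi * real q)"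
  shows "norm (phi (T + s) - phi T - quadratic_gauss_sum p q 0 / of_real (real q * sqrt pi) * csqrt (\<i> * of_real s))
     \<le> 5 * inverse_square_sum * (real q * sqrt (real q)) * (\<bar>s\<bar> * sqrt \<bar>s\<bar>)"
proof (cases "s = 0")
  case False
  let ?c = "quadratic_gauss_sum p q 0 / of_real (real q * sqrt pi)"
  let ?w = "\<lambda>e. complex_of_real e + \<i> * of_real s"
  have w: "((\<lambda>e. ?w e) \<longlongrightarrow> of_real 0 + \<i> * of_real s) (at_right 0)"
    by (intro tendsto_intros)
  have cs: "((\<lambda>e. csqrt (?w e)) \<longlongrightarrow> csqrt (\<i> * of_real s)) (at_right 0)"
    by (rule isCont_tendsto_compose[OF continuous_at_csqrt]) (use w False in \<open>auto simp: complex_nonpos_Reals_iff\<close>)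
  have ph: "((\<lambda>e. phi_ext (\<i> * of_real T + ?w e)) \<longlongrightarrow> phi_ext (\<i> * of_real T + (of_real 0 + \<i> * of_real s))) (at_right 0)"
  proof (rule continuous_on_tendsto_compose[OF continuous_on_phi_ext])
    show "((\<lambda>e. \<i> * of_real T + ?w e) \<longlongrightarrow> \<i> * of_real T + (of_real 0 + \<i> * of_real s)) (at_right 0)"
      by (intro tendsto_intros)
    show "\<forall>\<^sub>F e in at_right 0. \<i> * of_real T + ?w e \<in> {w. 0 \<le> Re w}"
      using eventually_at_right_less[of 0] by eventually_elim auto
  qed auto
  have "norm (phi_ext (\<i> * of_real T + (of_real 0 + \<i> * of_real s)) - phi_ext (\<i> * of_real T) - ?c * csqrt (\<i> * of_real s))
     \<le> 5 * inverse_square_sum * (real q * sqrt (real q)) * (norm (of_real 0 + \<i> * of_real s :: complex) * sqrt (norm (of_real 0 + \<i> * of_real s :: complex)))"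
  proof (rule tendsto_le)
    show "((\<lambda>e. norm (phi_ext (\<i> * of_real T + ?w e) - phi_ext (\<i> * of_real T) - ?c * csqrt (?w e))) \<longlongrightarrow>
        norm (phi_ext (\<i> * of_real T + (of_real 0 + \<i> * of_real s)) - phi_ext (\<i> * of_real T) - ?c * csqrt (\<i> * of_real s))) (at_right 0)"
      by (intro tendsto_intros ph cs)
    show "((\<lambda>e. 5 * inverse_square_sum * (real q * sqrt (real q)) * (norm (?w e) * sqrt (norm (?w e)))) \<longlongrightarrow>
       5 * inverse_square_sum * (real q * sqrt (real q)) * (norm (of_real 0 + \<i> * of_real s :: complex) * sqrt (norm (of_real 0 + \<i> * of_real s :: complex)))) (at_right 0)"
      by (intro tendsto_intros)
    show "\<forall>\<^sub>F e in at_right 0. norm (phi_ext (\<i> * of_real T + ?w e) - phi_ext (\<i> * of_real T) - ?c * csqrt (?w e))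
       \<le> 5 * inverse_square_sum * (real q * sqrt (real q)) * (norm (?w e) * sqrt (norm (?w e)))"
      using eventually_at_right_less[of 0]
      by eventually_elim (unfold T_def, intro phi_ext_asymp q cop, simp)
  qed simp
  moreover have "\<i> * of_real T + (of_real 0 + \<i> * of_real s) = \<i> * complex_of_real (T + s)" by (simp add: algebra_simps)
  ultimately show ?thesis unfolding phi_eq_phi_ext by (simp add: norm_mult)
qed simp

section \<open>Corners of the curve\<close>

text \<open>\<open>g (t + s0)\<close> is the vertex of an approximate right-angled corner with arms
  \<open>R * d\<close> and \<open>R * (\<i> * d)\<close>. If its three points were all nearly on the
  line through \<open>g t\<close> in direction \<open>v\<close>, both arms would be nearly
  orthogonal to \<open>\<i> * v\<close>, against Pythagoras. Since all three points are within
  \<open>M * R\<close> of \<open>g t\<close>, the deviation is visible from there, even when the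
  vertex differs from \<open>g t\<close>.\<close>

lemma not_tangent_if_corners:
  fixes g :: "real \<Rightarrow> complex" and v :: complex
  assumes cont: "continuous_on UNIV g" and v: "norm v = 1" and d0: "d0 > 0" and M: "M \<ge> 0"
    and corners: "\<And>e. e > 0 \<Longrightarrow> \<exists>R s0 s1 s2 d. R > 0 \<and> \<bar>s0\<bar> < e \<and> \<bar>s1\<bar> < e \<and> \<bar>s2\<bar> < e \<and> norm d = d0 \<and>
       norm (g (t + s0) - g t) \<le> M * R \<and> norm (g (t + s1) - g t) \<le> M * R \<and> norm (g (t + s2) - g t) \<le> M * R \<and>
       norm (g (t + s1) - g (t + s0) - of_real R * d) \<le> d0 / 2 * R \<and>
       norm (g (t + s2) - g (t + s0) - of_real R * (\<i> * d)) \<le> d0 / 2 * R"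
  shows "\<exists>a>0. \<not> ((\<lambda>h. H1_content ((g ` UNIV \<inter> cball (g t) h) - cone (g t) v a) / ennreal h) \<longlongrightarrow> 0) (at_right 0)"
proof (rule not_tangent_if_transverse[OF cont v])
  \<comment> \<open>With this \<open>c\<close> each of the three points deviates by at most
    \<open>d0 / 20 * R\<close>. Two such deviations and the error \<open>d0 / 2 * R\<close> bound
    the component of either arm by 3/5 of its length, and 2 * (3/5)^2 < 1. The summand 1 keeps the
    denominator positive when M is 0.\<close>
  define c where "c = d0 / (20 * (M + 1))"
  show "c > 0" using d0 M by (simp add: c_def)
  have cM: "c * M \<le> d0 / 20"
  proof -
    have "d0 * M \<le> d0 * (M + 1)" using d0 by simp
    then show ?thesis using M d0 by (simp add: c_def field_simps)
  qed
  fix e :: real assume "e > 0"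
  from corners[OF this] obtain R s0 s1 s2 d where R: "R > 0" and s: "\<bar>s0\<bar> < e" "\<bar>s1\<bar> < e" "\<bar>s2\<bar> < e" and d: "norm d = d0"
    and m: "norm (g (t + s0) - g t) \<le> M * R" "norm (g (t + s1) - g t) \<le> M * R" "norm (g (t + s2) - g t) \<le> M * R"
    and d1: "norm (g (t + s1) - g (t + s0) - of_real R * d) \<le> d0 / 2 * R"
    and d2: "norm (g (t + s2) - g (t + s0) - of_real R * (\<i> * d)) \<le> d0 / 2 * R"
    by metis
  define w where "w = \<i> * v"
  have w: "\<bar>w \<bullet> y\<bar> \<le> norm y" for y
    using Cauchy_Schwarz_ineq2[of w y] v by (simp add: w_def norm_mult)
  show "\<exists>s. \<bar>s\<bar> < e \<and> g (t + s) \<noteq> g t \<and> c * norm (g (t + s) - g t) \<le> \<bar>(\<i> * v) \<bullet> (g (t + s) - g t)\<bar>"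
  proof (rule ccontr)
    assume no: "\<not> ?thesis"
    have small: "\<bar>w \<bullet> (g (t + s) - g t)\<bar> \<le> d0 / 20 * R" if "\<bar>s\<bar> < e" "norm (g (t + s) - g t) \<le> M * R" for s
    proof -
      have "\<bar>w \<bullet> (g (t + s) - g t)\<bar> \<le> c * norm (g (t + s) - g t)"
        using no that(1) by (cases "g (t + s) = g t") (auto simp: w_def not_le intro: less_imp_le)
      also have "\<dots> \<le> c * (M * R)" using that(2) \<open>c > 0\<close> by (intro mult_left_mono) auto
      also have "\<dots> \<le> d0 / 20 * R" using cM R by (simp add: mult.assoc[symmetric])
      finally show ?thesis .
    qed
    have sm: "\<bar>w \<bullet> d'\<bar> \<le> 3 / 5 * d0" if "\<bar>s\<bar> < e" "norm (g (t + s) - g t) \<le> M * R"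
       "norm (g (t + s) - g (t + s0) - of_real R * d') \<le> d0 / 2 * R" for s d'
    proof -
      have "w \<bullet> (of_real R * d') = w \<bullet> (g (t + s) - g t) - w \<bullet> (g (t + s0) - g t) - w \<bullet> (g (t + s) - g (t + s0) - of_real R * d')"
        by (simp add: inner_diff_right)
      then have "\<bar>w \<bullet> (of_real R * d')\<bar> \<le> d0 / 20 * R + d0 / 20 * R + d0 / 2 * R"
        using small[OF that(1,2)] small[OF s(1) m(1)] order_trans[OF w that(3)] by linarith
      moreover have "w \<bullet> (of_real R * d') = R * (w \<bullet> d')"
        by (simp add: scaleR_conv_of_real[symmetric])
      ultimately have "R * \<bar>w \<bullet> d'\<bar> \<le> R * (3 / 5 * d0)" using R by (simp add: abs_mult field_simps)
      then show ?thesis using R by (rule mult_left_le_imp_le)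
    qed
    have "\<bar>w \<bullet> d\<bar> \<le> 3 / 5 * d0" "\<bar>w \<bullet> (\<i> * d)\<bar> \<le> 3 / 5 * d0"
      using sm[OF s(2) m(2) d1] sm[OF s(3) m(3) d2] by auto
    then have "(w \<bullet> d)\<^sup>2 \<le> (3 / 5 * d0)\<^sup>2" "(w \<bullet> (\<i> * d))\<^sup>2 \<le> (3 / 5 * d0)\<^sup>2"
      using power_mono[OF _ abs_ge_zero, of "w \<bullet> d" "3 / 5 * d0" 2]
        power_mono[OF _ abs_ge_zero, of "w \<bullet> (\<i> * d)" "3 / 5 * d0" 2] by (simp_all only: power2_abs)
    moreover have "w \<bullet> (\<i> * d) = v \<bullet> d" by (simp add: w_def inner_complex_def)
    then have "(w \<bullet> (\<i> * d))\<^sup>2 + (w \<bullet> d)\<^sup>2 = d0\<^sup>2"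
      using inner_ii_mult_Pythagoras[OF v, of d] by (simp add: w_def d)
    moreover have "0 < d0\<^sup>2" using d0 by simp
    ultimately show False by (simp add: power_mult_distrib power_divide)
  qed
qed

section \<open>Corners at rationals with odd denominator\<close>

lemma csqrt_ii_eq:
  fixes s :: real
  assumes "s > 0"
  shows "csqrt (\<i> * of_real s) = \<i> * csqrt (\<i> * of_real (- s))"
  using csqrt_minus[of "- (\<i> * of_real s)"] assms by simp

text \<open>At distance \<open>corner_scale / Q\<^sup>2\<close> from a rational with odd denominator \<open>Q\<close>, the error term of \<open>phi_asymp_rational\<close>
  is at most half of the main term.\<close>
definition corner_scale :: real where
  "corner_scale = 1 / (20 * (inverse_square_sum + 1))"

lemma corner_scale_bounds: "corner_scale > 0" "corner_scale \<le> 1"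
  "5 * inverse_square_sum * corner_scale \<le> 1 / 4"
  using inverse_square_sum_nonneg by (auto simp: corner_scale_def field_simps)

text \<open>For |s| \<le> 1/Q^2 both the main term, of order Q^(-1/2) |s|^(1/2), and the error, of
  order Q^(3/2) |s|^(3/2), are O(Q^(-3/2)). The lemma places \<open>phi t\<close> itself, and not
  only the corner, at this distance from the vertex.\<close>

lemma phi_near_odd_rational:
  assumes Q: "odd Q" and cop: "coprime P (int Q)" and s: "\<bar>s\<bar> \<le> 1 / (real Q)\<^sup>2"
  shows "norm (phi (of_int P / (2 * pi * real Q) + s) - phi (of_int P / (2 * pi * real Q)))
     \<le> (1 + 5 * inverse_square_sum) * (1 / (real Q * sqrt (real Q)))"
proof -
  have Q0: "Q > 0" using Q by (rule odd_pos)
  let ?T = "of_int P / (2 * pi * real Q)"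
  let ?A = "quadratic_gauss_sum P Q 0 / of_real (real Q * sqrt pi)"
  have sq: "sqrt \<bar>s\<bar> \<le> 1 / real Q"
    using s Q0 by (intro real_le_lsqrt) (auto simp: power_divide)
  have nA: "norm ?A = 1 / (sqrt (real Q) * sqrt pi)"
    using Q0 norm_quadratic_gauss_sum_odd[OF Q cop] by (simp add: norm_divide norm_mult field_simps)
  have "norm (?A * csqrt (\<i> * of_real s)) \<le> 1 / (real Q * sqrt (real Q))"
  proof -
    have "norm (?A * csqrt (\<i> * of_real s)) = 1 / (sqrt (real Q) * sqrt pi) * sqrt \<bar>s\<bar>"
      unfolding norm_mult nA norm_csqrt_eq by (simp add: norm_mult)
    also have "\<dots> \<le> 1 / (sqrt (real Q) * 1) * (1 / real Q)"
      using sq Q0 pi_ge_two by (intro mult_mono divide_left_mono mult_left_mono) auto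
    finally show ?thesis by (simp add: mult.commute)
  qed
  moreover have "5 * inverse_square_sum * (real Q * sqrt (real Q)) * (\<bar>s\<bar> * sqrt \<bar>s\<bar>) \<le> 5 * inverse_square_sum * (1 / (real Q * sqrt (real Q)))"
  proof -
    have "\<bar>s\<bar> * sqrt \<bar>s\<bar> \<le> 1 / (real Q)\<^sup>2 * (1 / real Q)" using s sq by (intro mult_mono) auto
    then have "(real Q * sqrt (real Q)) * (\<bar>s\<bar> * sqrt \<bar>s\<bar>) \<le> (real Q * sqrt (real Q)) * (1 / (real Q)\<^sup>2 * (1 / real Q))"
      by (intro mult_left_mono) auto
    also have "\<dots> = 1 / (real Q * sqrt (real Q))"
      using Q0 by (simp add: field_simps power2_eq_square)
    finally have "5 * inverse_square_sum * ((real Q * sqrt (real Q)) * (\<bar>s\<bar> * sqrt \<bar>s\<bar>)) \<le> 5 * inverse_square_sum * (1 / (real Q * sqrt (real Q)))"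
      using inverse_square_sum_nonneg by (intro mult_left_mono) auto
    then show ?thesis by (simp only: mult.assoc)
  qed
  ultimately have "norm ((phi (?T + s) - phi ?T - ?A * csqrt (\<i> * of_real s)) + ?A * csqrt (\<i> * of_real s))
      \<le> 5 * inverse_square_sum * (1 / (real Q * sqrt (real Q))) + 1 / (real Q * sqrt (real Q))"
    using phi_asymp_rational[OF Q0 cop, of s] by (intro norm_triangle_le) linarith
  then show ?thesis by (simp add: add_divide_distrib)
qed

text \<open>The exact modulus sqrt Q of the Gauss sum makes the rescaled arm length
  \<open>d0\<close> independent of P and Q, as a sequence of corners with a common \<open>d0\<close>
  requires.\<close>

lemma phi_corner_odd_rational:
  assumes Q: "odd Q" and cop: "coprime P (int Q)"
  defines "T \<equiv> of_int P / (2 * pi * real Q)" and "\<delta> \<equiv> corner_scale / (real Q)\<^sup>2" and "R \<equiv> 1 / (real Q * sqrt (real Q))"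
    and "d0 \<equiv> sqrt (corner_scale / pi)"
  obtains d where "norm d = d0" 
    "norm (phi (T - \<delta>) - phi T - of_real R * d) \<le> d0 / 2 * R"
    "norm (phi (T + \<delta>) - phi T - of_real R * (\<i> * d)) \<le> d0 / 2 * R"
proof -
  have Q0: "Q > 0" using Q by (rule odd_pos)
  let ?A = "quadratic_gauss_sum P Q 0 / of_real (real Q * sqrt pi)"
  have \<delta>: "\<delta> > 0" using Q0 corner_scale_bounds by (simp add: \<delta>_def)
  have sq\<delta>: "sqrt \<delta> = sqrt corner_scale / real Q" by (simp add: \<delta>_def real_sqrt_divide)
  have R: "R > 0" using Q0 by (simp add: R_def)
  define d where "d = ?A * csqrt (\<i> * of_real (- \<delta>)) / of_real R"
  have Rd: "of_real R * d = ?A * csqrt (\<i> * of_real (- \<delta>))" using R by (simp add: d_def)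
  have Rd': "of_real R * (\<i> * d) = ?A * csqrt (\<i> * of_real \<delta>)"
    unfolding csqrt_ii_eq[OF \<delta>] using Rd by (simp add: mult_ac)
  have nA: "norm ?A = 1 / (sqrt (real Q) * sqrt pi)"
    using Q0 norm_quadratic_gauss_sum_odd[OF Q cop] by (simp add: norm_divide norm_mult field_simps)
  have "norm d = 1 / (sqrt (real Q) * sqrt pi) * sqrt \<delta> / R"
    unfolding d_def norm_divide[of "_ * _"] norm_mult[of ?A] nA norm_csqrt_eq using \<delta> R by (simp add: norm_mult)
  also have "\<dots> = d0"
    unfolding sq\<delta> R_def d0_def real_sqrt_divide using Q0 by (simp add: field_simps)
  finally have d: "norm d = d0" .
  have err: "5 * inverse_square_sum * (real Q * sqrt (real Q)) * (\<delta> * sqrt \<delta>) \<le> d0 / 2 * R"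
  proof -
    \<comment> \<open>The main term carries the factor 1 / sqrt pi, of which half is allowed as
      error; sqrt pi \<le> 2 shows that the bound 1/4 in \<open>corner_scale_bounds\<close> is small
      enough.\<close>
    have "sqrt pi \<le> sqrt 4" using pi_less_4 by (intro real_sqrt_le_mono) simp
    then have "1 / 4 \<le> 1 / (2 * sqrt pi)" by (simp add: field_simps)
    then have "5 * inverse_square_sum * corner_scale \<le> 1 / (2 * sqrt pi)" using corner_scale_bounds(3) by linarith
    then have f1: "(5 * inverse_square_sum * corner_scale) * (sqrt corner_scale * R) \<le> 1 / (2 * sqrt pi) * (sqrt corner_scale * R)"
      using R corner_scale_bounds(1) by (intro mult_right_mono) auto
    have f2: "1 / (2 * sqrt pi) * (sqrt corner_scale * R) = d0 / 2 * R" by (simp add: d0_def real_sqrt_divide)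
    have "(real Q * sqrt (real Q)) * (\<delta> * sqrt \<delta>) = corner_scale * sqrt corner_scale * R"
      unfolding sq\<delta> unfolding \<delta>_def R_def using Q0 by (simp add: field_simps power2_eq_square)
    then have "5 * inverse_square_sum * ((real Q * sqrt (real Q)) * (\<delta> * sqrt \<delta>)) = (5 * inverse_square_sum * corner_scale) * (sqrt corner_scale * R)"
      by (simp only: mult.assoc)
    then show ?thesis using f1 unfolding f2 by (simp only: mult.assoc)
  qed
  show ?thesis
  proof (rule that[OF d])
    show "norm (phi (T - \<delta>) - phi T - of_real R * d) \<le> d0 / 2 * R"
      using phi_asymp_rational[OF Q0 cop, of "- \<delta>"] err \<delta> unfolding Rd T_def[symmetric] by simp
    show "norm (phi (T + \<delta>) - phi T - of_real R * (\<i> * d)) \<le> d0 / 2 * R"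
      using phi_asymp_rational[OF Q0 cop, of \<delta>] err \<delta> unfolding Rd' T_def[symmetric] by simp
  qed
qed

text \<open>This serves the two cases in which the corners are taken near t rather than at t:
  irrational \<open>2 * pi * t\<close>, and a rational with vanishing Gauss sum. They differ only in
  how the distance of the corner from \<open>phi t\<close> is bounded.\<close>

lemma not_tangent_if_odd_rationals:
  fixes v :: complex and t :: real
  assumes v: "norm v = 1" and M: "M \<ge> 0"
    and ex: "\<And>e. e > 0 \<Longrightarrow> \<exists>P Q. odd Q \<and> coprime P (int Q) \<and>
       (\<forall>s. \<bar>s\<bar> \<le> corner_scale / (real Q)\<^sup>2 \<longrightarrow> \<bar>of_int P / (2 * pi * real Q) + s - t\<bar> < e \<and>
          norm (phi (of_int P / (2 * pi * real Q) + s) - phi t) \<le> M * (1 / (real Q * sqrt (real Q))))"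
  shows "\<exists>a>0. \<not> ((\<lambda>h. H1_content ((phi ` UNIV \<inter> cball (phi t) h) - cone (phi t) v a) / ennreal h) \<longlongrightarrow> 0) (at_right 0)"
proof (rule not_tangent_if_corners[OF continuous_on_phi v _ M])
  show "sqrt (corner_scale / pi) > 0" using corner_scale_bounds by simp
  fix e :: real assume "e > 0"
  then obtain P Q where Q: "odd Q" and cop: "coprime P (int Q)"
    and near: "\<And>s. \<bar>s\<bar> \<le> corner_scale / (real Q)\<^sup>2 \<Longrightarrow> \<bar>of_int P / (2 * pi * real Q) + s - t\<bar> < e"
    and bd: "\<And>s. \<bar>s\<bar> \<le> corner_scale / (real Q)\<^sup>2 \<Longrightarrow>
          norm (phi (of_int P / (2 * pi * real Q) + s) - phi t) \<le> M * (1 / (real Q * sqrt (real Q)))"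
    using ex by metis
  define T where "T = of_int P / (2 * pi * real Q)"
  define \<delta> where "\<delta> = corner_scale / (real Q)\<^sup>2"
  define R where "R = 1 / (real Q * sqrt (real Q))"
  have \<delta>: "\<delta> \<ge> 0" using corner_scale_bounds by (simp add: \<delta>_def)
  have R: "R > 0" using odd_pos[OF Q] by (simp add: R_def)
  obtain d where d: "norm d = sqrt (corner_scale / pi)"
    "norm (phi (T - \<delta>) - phi T - of_real R * d) \<le> sqrt (corner_scale / pi) / 2 * R"
    "norm (phi (T + \<delta>) - phi T - of_real R * (\<i> * d)) \<le> sqrt (corner_scale / pi) / 2 * R"
    using phi_corner_odd_rational[OF Q cop] unfolding T_def \<delta>_def R_def by blast
  have e: "\<bar>T - t\<bar> < e" "\<bar>T - \<delta> - t\<bar> < e" "\<bar>T + \<delta> - t\<bar> < e"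
    using near[of 0] near[of "- \<delta>"] near[of \<delta>] \<delta> by (auto simp: T_def \<delta>_def)
  have b: "norm (phi T - phi t) \<le> M * R" "norm (phi (T - \<delta>) - phi t) \<le> M * R" "norm (phi (T + \<delta>) - phi t) \<le> M * R"
    using bd[of 0] bd[of "- \<delta>"] bd[of \<delta>] \<delta> by (auto simp: T_def \<delta>_def R_def)
  show "\<exists>R s0 s1 s2 d. R > 0 \<and> \<bar>s0\<bar> < e \<and> \<bar>s1\<bar> < e \<and> \<bar>s2\<bar> < e \<and> norm d = sqrt (corner_scale / pi) \<and>
       norm (phi (t + s0) - phi t) \<le> M * R \<and> norm (phi (t + s1) - phi t) \<le> M * R \<and> norm (phi (t + s2) - phi t) \<le> M * R \<and>
       norm (phi (t + s1) - phi (t + s0) - of_real R * d) \<le> sqrt (corner_scale / pi) / 2 * R \<and>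
       norm (phi (t + s2) - phi (t + s0) - of_real R * (\<i> * d)) \<le> sqrt (corner_scale / pi) / 2 * R"
    using R e b d by (intro exI[of _ R] exI[of _ "T - t"] exI[of _ "T - \<delta> - t"] exI[of _ "T + \<delta> - t"] exI[of _ d]) simp
qed

lemma irrational_approx_odd:
  fixes x :: real and N :: nat
  assumes x: "x \<notin> \<rat>"
  obtains P :: int and Q :: nat where "odd Q" "coprime P (int Q)" "Q > N" "\<bar>x - of_int P / real Q\<bar> \<le> 6 / (real Q)\<^sup>2"
proof -
  \<comment> \<open>The smallest distance from a multiple \<open>k * x\<close> with 1 \<le> k \<le>
    N to the integers is positive by irrationality. An approximation better than that must have a
    denominator above N. The inserted 1 keeps the set nonempty when N is 0.\<close>
  define \<mu> where "\<mu> = Min (insert 1 ((\<lambda>k. \<bar>of_int k * x - of_int (round (of_int k * x))\<bar>) ` {1..int N}))"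
  have pos: "\<bar>of_int k * x - of_int h\<bar> > 0" if "k > 0" for k h :: int
  proof -
    have "of_int k * x \<noteq> of_int h"
    proof
      assume "of_int k * x = of_int h"
      then have "x = of_int h / of_int k" using that by (simp add: field_simps)
      then show False using x by auto
    qed
    then show ?thesis by simp
  qed
  have \<mu>: "\<mu> > 0" unfolding \<mu>_def using pos by (subst Min_gr_iff) auto
  have \<mu>_le: "\<mu> \<le> \<bar>of_int k * x - of_int h\<bar>" if "0 < k" "k \<le> int N" for k h :: int
  proof -
    have "\<mu> \<le> \<bar>of_int k * x - of_int (round (of_int k * x))\<bar>"
      unfolding \<mu>_def using that by (intro Min_le) auto
    also have "\<dots> \<le> \<bar>of_int k * x - of_int h\<bar>" by (rule round_diff_minimal)
    finally show ?thesis .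
  qed
  obtain m :: nat where m: "m > 0" "inverse (real m) < \<mu>" using ex_inverse_of_nat_less[OF \<mu>] by blast
  obtain h k where hk: "coprime h k" "0 < k" "k \<le> int m" "\<bar>of_int k * x - of_int h\<bar> < 1 / real m"
    using Dirichlet_approx_coprime[OF m(1)] by blast
  have kN: "k > int N" using \<mu>_le[of k h] hk m by (force simp: divide_inverse)
  have "\<bar>x - of_int h / of_int k\<bar> * of_int k = \<bar>of_int k * x - of_int h\<bar>"
    using hk(2) by (simp add: abs_if field_simps)
  also have "\<dots> \<le> 1 / of_int k" using hk m by (smt (verit) frac_le of_int_0_less_iff of_int_le_iff of_int_of_nat_eq)
  finally have a1: "\<bar>x - of_int h / of_int k\<bar> \<le> 1 / (of_int k)\<^sup>2"
    using hk(2) by (simp add: field_simps power2_eq_square)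
  show ?thesis
  proof (cases "odd k")
    case True
    have "1 / (of_int k)\<^sup>2 \<le> 6 / (of_int k :: real)\<^sup>2" by (simp add: divide_right_mono)
    with True hk kN a1 show ?thesis
      by (intro that[of "nat k" h]) (auto simp: even_nat_iff)
  next
    case False
    \<comment> \<open>An even denominator is replaced by that of a Farey neighbour, which is odd.\<close>
    obtain u0 where "[h * u0 = 1] (mod k)" using cong_solve_coprime_int[OF hk(1)] by auto
    then have u1: "[h * (u0 mod k) = 1] (mod k)" by (simp add: cong_def mod_simps)
    \<comment> \<open>Adding \<open>k\<close> to the reduced inverse of \<open>h\<close> puts
      \<open>k'\<close> between \<open>k\<close> and \<open>2 * k\<close>. The lower end preserves
      \<open>k' > N\<close>; the upper end bounds 1/k^2 by 4/k'^2 and the Farey gap 1/(k k') by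
      2/k'^2, which makes 6.\<close>
    define k' where "k' = u0 mod k + k"
    have k': "k \<le> k'" "k' < 2 * k" using hk(2) by (auto simp: k'_def)
    have "[h * k' = 1] (mod k)" using u1 by (simp add: k'_def cong_def distrib_left mod_simps)
    then obtain h' where h': "h * k' - 1 = k * h'" by (metis cong_iff_dvd_diff dvd_def)
    have e1: "h * k' = 1 + k * h'" using h' by simp
    have odd: "odd k'" using e1 False by (metis even_mult_iff even_plus_one_iff add.commute)
    have "h' * (- k) + k' * h = 1" using e1 by (simp add: algebra_simps)
    then have cop: "coprime h' k'" by (metis coprimeI dvd_add dvd_mult2)
    have "\<bar>of_int h / of_int k - of_int h' / of_int k'\<bar> = 1 / (real_of_int k * of_int k')"
    proof -
      have "real_of_int h * of_int k' - of_int k * of_int h' = 1"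
        using e1 by (metis add_diff_cancel_right' of_int_1 of_int_diff of_int_mult)
      then have "of_int h / of_int k - of_int h' / of_int k' = 1 / (real_of_int k * of_int k')"
        using hk(2) k' by (simp add: field_simps)
      then show ?thesis using hk(2) k' by simp
    qed
    then have "\<bar>x - of_int h' / of_int k'\<bar> \<le> 1 / (of_int k)\<^sup>2 + 1 / (real_of_int k * of_int k')"
      using a1 abs_triangle_ineq[of "x - of_int h / of_int k" "of_int h / of_int k - of_int h' / of_int k'"] by simp
    also have "1 / (of_int k)\<^sup>2 \<le> 4 / (real_of_int k')\<^sup>2"
    proof -
      have "(real_of_int k')\<^sup>2 \<le> (2 * of_int k)\<^sup>2" using k' hk(2) by (intro power_mono) auto
      then show ?thesis using k' hk(2) by (simp add: field_simps power_mult_distrib)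
    qed
    also have "1 / (real_of_int k * of_int k') \<le> 2 / (real_of_int k')\<^sup>2"
    proof -
      have "real_of_int k' * of_int k' \<le> (2 * of_int k) * of_int k'" using k' hk(2) by (intro mult_right_mono) auto
      then show ?thesis using k' hk(2) by (simp add: field_simps power2_eq_square)
    qed
    finally have "\<bar>x - of_int h' / of_int k'\<bar> \<le> 6 / (of_int k')\<^sup>2" by simp
    then show ?thesis
      using odd cop k' kN hk(2) by (intro that[of "nat k'" h']) (auto simp: even_nat_iff)
  qed
qed

theorem theorem3:
  fixes t :: real and v :: complex
  assumes "norm v = 1"
  shows "\<not> is_tangent v t \<and>
    (\<exists>a>0. \<not> ((\<lambda>h. H1_content ((phi ` UNIV \<inter> cball (phi t) h)
        - cone (phi t) v a) / ennreal h) \<longlongrightarrow> 0) (at_right 0))"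
proof -
  let ?Z = inverse_square_sum
  define x where "x = 2 * pi * t"
  have t: "t = x / (2 * pi)" by (simp add: x_def)
  have "\<exists>a>0. \<not> ((\<lambda>h. H1_content ((phi ` UNIV \<inter> cball (phi t) h) - cone (phi t) v a) / ennreal h) \<longlongrightarrow> 0) (at_right 0)"
  proof (cases "x \<in> \<rat>")
    case False
    define B where "B = 1 + 5 * ?Z"
    show ?thesis
    \<comment> \<open>Both \<open>phi (?T + s)\<close> and \<open>phi t\<close> are within B
      Q^(-3/2) of the vertex \<open>phi ?T\<close>, hence the factor 2.\<close>
    proof (rule not_tangent_if_odd_rationals[OF assms, of "2 * B"])
      show "2 * B \<ge> 0" using inverse_square_sum_nonneg by (simp add: B_def)
      fix e :: real assume e: "e > 0"
      obtain N :: nat where N: "2 / e < real N" using reals_Archimedean2 by blast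
      obtain P Q where Q: "odd Q" and cop: "coprime P (int Q)" and QN: "Q > N" and app: "\<bar>x - of_int P / real Q\<bar> \<le> 6 / (real Q)\<^sup>2"
        using irrational_approx_odd[OF False] by blast
      let ?T = "of_int P / (2 * pi * real Q)"
      have Q1: "real Q \<ge> 1" using odd_pos[OF Q] by simp
      \<comment> \<open>Passing from x to t divides by 2 pi > 6, which absorbs the constant 6 and
        brings t into the range of \<open>phi_near_odd_rational\<close>.\<close>
      have Tt: "\<bar>t - ?T\<bar> \<le> 1 / (real Q)\<^sup>2"
      proof -
        have "t - ?T = (x - of_int P / real Q) / (2 * pi)" by (simp add: t diff_divide_distrib mult.commute)
        then have "\<bar>t - ?T\<bar> = \<bar>x - of_int P / real Q\<bar> / (2 * pi)" by (simp add: abs_divide)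
        also have "\<dots> \<le> (6 / (real Q)\<^sup>2) / 6" using app pi_gt3 by (intro frac_le) auto
        finally show ?thesis by simp
      qed
      show "\<exists>P Q. odd Q \<and> coprime P (int Q) \<and>
       (\<forall>s. \<bar>s\<bar> \<le> corner_scale / (real Q)\<^sup>2 \<longrightarrow> \<bar>of_int P / (2 * pi * real Q) + s - t\<bar> < e \<and>
          norm (phi (of_int P / (2 * pi * real Q) + s) - phi t) \<le> 2 * B * (1 / (real Q * sqrt (real Q))))"
      proof (intro exI[of _ P] exI[of _ Q] conjI Q cop allI impI)
        fix s assume "\<bar>s\<bar> \<le> corner_scale / (real Q)\<^sup>2"
        also have "\<dots> \<le> 1 / (real Q)\<^sup>2" using corner_scale_bounds by (intro divide_right_mono) auto
        finally have s: "\<bar>s\<bar> \<le> 1 / (real Q)\<^sup>2" .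
        have "2 / (real Q)\<^sup>2 \<le> 2 / real Q" using Q1 by (intro divide_left_mono) (auto simp: power2_eq_square)
        also have "\<dots> < e"
        proof -
          have "2 / e < real Q" using N QN by linarith
          then show ?thesis using e Q1 by (simp add: field_simps)
        qed
        finally have "2 / (real Q)\<^sup>2 < e" .
        then show "\<bar>?T + s - t\<bar> < e" using s Tt by (simp add: abs_le_iff abs_less_iff)
        have "norm (phi (?T + s) - phi ?T) \<le> B * (1 / (real Q * sqrt (real Q)))"
          unfolding B_def by (rule phi_near_odd_rational[OF Q cop s])
        moreover have "norm (phi (?T + (t - ?T)) - phi ?T) \<le> B * (1 / (real Q * sqrt (real Q)))"
          unfolding B_def by (rule phi_near_odd_rational[OF Q cop Tt])
        ultimately have "norm ((phi (?T + s) - phi ?T) - (phi (?T + (t - ?T)) - phi ?T)) \<le> B * (1 / (real Q * sqrt (real Q))) + B * (1 / (real Q * sqrt (real Q)))"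
          by (rule order_trans[OF norm_triangle_ineq4 add_mono])
        then show "norm (phi (?T + s) - phi t) \<le> 2 * B * (1 / (real Q * sqrt (real Q)))" by simp
      qed
    qed
  next
    case True
    then obtain p q' where q': "q' > 0" "coprime p q'" "x = of_int p / of_int q'" by (rule Rats_cases')
    define q where "q = nat q'"
    have q: "q > 0" "coprime p (int q)" and tq: "t = of_int p / (2 * pi * real q)"
      using q' by (auto simp: q_def t mult.commute)
    define A where "A = quadratic_gauss_sum p q 0 / of_real (real q * sqrt pi)"
    define C where "C = 5 * ?Z * (real q * sqrt (real q))"
    have C: "C \<ge> 0" using inverse_square_sum_nonneg by (simp add: C_def)
    have asym: "norm (phi (t + s) - phi t - A * csqrt (\<i> * of_real s)) \<le> C * (\<bar>s\<bar> * sqrt \<bar>s\<bar>)" for s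
      unfolding tq A_def C_def by (rule phi_asymp_rational[OF q])
    show ?thesis
    proof (cases "A = 0")
      case False
      define d0 where "d0 = norm A"
      have d0: "d0 > 0" using False by (simp add: d0_def)
      show ?thesis
      proof (rule not_tangent_if_corners[OF continuous_on_phi assms d0, of "2 * d0"])
        fix e :: real assume e: "e > 0"
        \<comment> \<open>The second entry makes \<open>C * s\<close> at most \<open>d0 / 2\<close>,
          so the error is at most half of the arm length \<open>d0 * sqrt s\<close>; C + 1 avoids
          division by 0. Here the vertex is \<open>phi t\<close> itself and the scale is
          \<open>sqrt s\<close>.\<close>
        define s where "s = min (e / 2) (d0 / (2 * (C + 1)))"
        have s: "s > 0" "s < e" using e d0 C by (auto simp: s_def)
        have "C * s \<le> (C + 1) * (d0 / (2 * (C + 1)))" using C d0 s(1) by (intro mult_mono) (auto simp: s_def)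
        also have "\<dots> = d0 / 2" using C by (simp add: field_simps)
        finally have Cs: "C * (s * sqrt s) \<le> d0 / 2 * sqrt s" using s by (simp add: mult.assoc[symmetric])
        define d where "d = A * csqrt (\<i> * of_real (- s)) / of_real (sqrt s)"
        have sq: "sqrt s > 0" using s by simp
        have Rd: "of_real (sqrt s) * d = A * csqrt (\<i> * of_real (- s))" using s by (simp add: d_def)
        have Rd': "of_real (sqrt s) * (\<i> * d) = A * csqrt (\<i> * of_real s)"
          unfolding csqrt_ii_eq[OF s(1)] using Rd by (simp add: mult_ac)
        have d: "norm d = d0" unfolding d_def norm_divide norm_mult[of A] norm_csqrt_eq
          using s by (simp add: norm_mult d0_def)
        have d1: "norm (phi (t + - s) - phi (t + 0) - of_real (sqrt s) * d) \<le> d0 / 2 * sqrt s"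
          using order_trans[OF asym[of "- s"], of "d0 / 2 * sqrt s"] Cs s(1) unfolding Rd by (simp only: abs_minus_cancel abs_of_pos add_0_right)
        have d2: "norm (phi (t + s) - phi (t + 0) - of_real (sqrt s) * (\<i> * d)) \<le> d0 / 2 * sqrt s"
          using order_trans[OF asym[of s], of "d0 / 2 * sqrt s"] Cs s(1) unfolding Rd' by (simp only: abs_of_pos add_0_right)
        have b: "norm y \<le> 2 * d0 * sqrt s" if "norm (y - of_real (sqrt s) * d') \<le> d0 / 2 * sqrt s" "norm d' = d0" for y d' :: complex
        proof -
          have "norm ((y - of_real (sqrt s) * d') + of_real (sqrt s) * d') \<le> d0 / 2 * sqrt s + sqrt s * d0"
            using that s by (intro order_trans[OF norm_triangle_ineq] add_mono) (auto simp: norm_mult)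
          also have "\<dots> \<le> 2 * d0 * sqrt s" using d0 sq by (simp add: algebra_simps)
          finally show ?thesis by simp
        qed
        show "\<exists>R s0 s1 s2 d. R > 0 \<and> \<bar>s0\<bar> < e \<and> \<bar>s1\<bar> < e \<and> \<bar>s2\<bar> < e \<and> norm d = d0 \<and>
           norm (phi (t + s0) - phi t) \<le> 2 * d0 * R \<and> norm (phi (t + s1) - phi t) \<le> 2 * d0 * R \<and> norm (phi (t + s2) - phi t) \<le> 2 * d0 * R \<and>
           norm (phi (t + s1) - phi (t + s0) - of_real R * d) \<le> d0 / 2 * R \<and>
           norm (phi (t + s2) - phi (t + s0) - of_real R * (\<i> * d)) \<le> d0 / 2 * R"
          using sq s e d d1 d2 d0 b[of "phi (t + - s) - phi t" d] b[of "phi (t + s) - phi t" "\<i> * d"]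
          by (intro exI[of _ "sqrt s"] exI[of _ 0] exI[of _ "- s"] exI[of _ s] exI[of _ d]) (auto simp: norm_mult)
      qed (use d0 in simp)
    next
      case True
      have bd: "norm (phi (t + s) - phi t) \<le> C * (\<bar>s\<bar> * sqrt \<bar>s\<bar>)" for s using asym[of s] True by simp
      show ?thesis
      \<comment> \<open>A rational x is at distance at least a fixed multiple of 1/Q from every
        other fraction with denominator Q, so order 1/Q is all that can be expected. By
        \<open>bd\<close> a parameter distance of at most 2/Q gives (2/Q)^(3/2) = 2 sqrt 2 Q^(-3/2),
        the size of the corner.\<close>
      proof (rule not_tangent_if_odd_rationals[OF assms, of "C * (2 * sqrt 2)"])
        show "C * (2 * sqrt 2) \<ge> 0" using C by simp
        fix e :: real assume e: "e > 0"
        obtain N :: nat where N: "2 / e < real N" using reals_Archimedean2 by blast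
        \<comment> \<open>For a power of 3, coprimality only excludes multiples of 3, so one of two
          consecutive integers next to \<open>x * Q\<close> can serve as numerator, and Q is odd and
          as large as desired.\<close>
        define Q :: nat where "Q = 3 ^ N"
        have Q: "odd Q" by (simp add: Q_def)
        have "N < Q" unfolding Q_def by (rule power_gt_expt) simp
        define P where "P = (if 3 dvd \<lfloor>x * real Q\<rfloor> then \<lfloor>x * real Q\<rfloor> + 1 else \<lfloor>x * real Q\<rfloor>)"
        have "\<not> 3 dvd P" unfolding P_def by presburger
        moreover have "prime (3::int)" by simp
        ultimately have "coprime P 3" using prime_imp_coprime coprime_commute by blast
        then have cop: "coprime P (int Q)" by (simp add: Q_def)
        have Q1: "real Q \<ge> 1" by (simp add: Q_def)
        let ?T = "of_int P / (2 * pi * real Q)"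
        have Tt: "\<bar>?T - t\<bar> \<le> 1 / real Q"
        proof -
          have "\<bar>of_int P - x * real Q\<bar> \<le> 1" unfolding P_def by (auto simp: abs_le_iff) linarith+
          then have "\<bar>of_int P - x * real Q\<bar> / \<bar>2 * pi * real Q\<bar> \<le> 1 / real Q"
            using Q1 pi_ge_two by (intro frac_le) (auto simp: abs_mult mult_le_cancel_right1)
          moreover have "?T - t = (of_int P - x * real Q) / (2 * pi * real Q)"
            using Q1 by (simp add: t diff_divide_distrib)
          ultimately show ?thesis by (simp only: abs_divide)
        qed
        show "\<exists>P Q. odd Q \<and> coprime P (int Q) \<and>
         (\<forall>s. \<bar>s\<bar> \<le> corner_scale / (real Q)\<^sup>2 \<longrightarrow> \<bar>of_int P / (2 * pi * real Q) + s - t\<bar> < e \<and>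
            norm (phi (of_int P / (2 * pi * real Q) + s) - phi t) \<le> C * (2 * sqrt 2) * (1 / (real Q * sqrt (real Q))))"
        proof (intro exI[of _ P] exI[of _ Q] conjI Q cop allI impI)
          fix s assume "\<bar>s\<bar> \<le> corner_scale / (real Q)\<^sup>2"
          also have "\<dots> \<le> 1 / real Q" using corner_scale_bounds Q1 by (intro frac_le) (auto simp: power2_eq_square)
          finally have s: "\<bar>?T + s - t\<bar> \<le> 2 / real Q" using Tt by (simp add: abs_le_iff)
          also have "2 / real Q < e"
          proof -
            have "2 / e < real Q" using N \<open>N < Q\<close> by linarith
            then show ?thesis using e Q1 by (simp add: field_simps)
          qed
          finally show "\<bar>?T + s - t\<bar> < e" .
          have "norm (phi (t + (?T + s - t)) - phi t) \<le> C * (\<bar>?T + s - t\<bar> * sqrt \<bar>?T + s - t\<bar>)" by (rule bd)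
          also have "\<dots> \<le> C * (2 / real Q * sqrt (2 / real Q))"
            using s C by (intro mult_left_mono mult_mono) auto
          also have "\<dots> = C * (2 * sqrt 2) * (1 / (real Q * sqrt (real Q)))" by (simp add: real_sqrt_divide)
          finally show "norm (phi (?T + s) - phi t) \<le> C * (2 * sqrt 2) * (1 / (real Q * sqrt (real Q)))" by simp
        qed
      qed
    qed
  qed
  then show ?thesis unfolding is_tangent_def by blast
qed

end
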